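(* Let $\mu\in(0,1]$, $\bar t^\mu=\mu\sqrt2$, $t\in\Omega^\mu\cap[\bar t^\mu,\infty)$, and let $n_t\in\mathbb{N}$ be sufficiently large that $\tau=t/n_t\in(0,\bar t^\mu)$. Then, for all $\xi,\zeta\in\mathscr{X}_1$, $$\widetilde{G}_t^\mu(\xi,\zeta)=\operatorname*{stat}_{\eta\in(\mathscr{X}_1)^{n_t-1}}\left\{G_\tau^\mu(\xi,\eta_1)+\sum_{k=2}^{n_t-1}G_\tau^\mu(\eta_{k-1},\eta_k)+G_\tau^\mu(\eta_{n_t-1},\zeta)\right\},$$ where $(\mathscr{X}_1)^{n_t-1}$ is the product of $n_t-1$ copies of $\mathscr{X}_1$ and $\eta=(\eta_1,\dots,\eta_{n_t-1})$. Furthermore, for every $k\in\{1,\dots,n_t-1\}$, $$\widetilde{G}_t^\mu(\xi,\zeta)=\operatorname*{stat}_{\eta\in\mathscr{X}_1}\left\{\widetilde{G}_{k\tau}^\mu(\xi,\eta)+\widetilde{G}_{(n_t-k)\tau}^\mu(\eta,\zeta)\right\}=\widetilde{G}_{k\tau}^\mu(\xi,\eta_k^* )+\widetilde{G}_{(n_t-k)\tau}^\mu(\eta_k^*,\zeta),$$ in which the stat is achieved at $$\eta_k^*=-\left[\widetilde{\mathcal{P}}_{k\tau}^\mu+\widetilde{\mathcal{P}}_{(n_t-k)\tau}^\mu\right]^{-1}\left(\widetilde{\mathcal{Q}}_{k\tau}^\mu\,\xi+\widetilde{\mathcal{Q}}_{(n_t-k)\tau}^\mu\,\zeta\right)\i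n\mathscr{X}_1.$$
   Context: $\mathscr{X}$ is a real $L_2$-space with inner product $\langle\cdot,\cdot\rangle$ and norm $\|\cdot\|$. $\Lambda$ is a linear, unbounded, positive, self-adjoint operator with domain $\mathscr{X}_2=\mathrm{dom}(\Lambda)$ dense in $\mathscr{X}$ and compact inverse $\Lambda^{-1}\in\mathcal{L}(\mathscr{X})$. $\Lambda^{1/2}$ is its unique positive self-adjoint square root, and $\mathscr{X}_1=\mathrm{dom}(\Lambda^{1/2})$ is a Hilbert space with $\langle x,\xi\rangle_1=\langle\Lambda^{1/2}x,\Lambda^{1/2}\xi\rangle$ and norm $\|\cdot\|_1$. $\{\varphi_n\}_{n\in\mathbb{N}}$ is an orthonormal basis of $\mathscr{X}$ of eigenvectors of $\Lambda$, $\Lambda\varphi_n=\lambda_n\varphi_n$, with $0<\lambda_1\le\lambda_2\le\cdots\to\infty$ (repeated according to multiplicity), and $\tilde\varphi_n=\varphi_n/\sqrt{\lambda_n}$, an orthonormal basis of $\mathscr{X}_1$. For $\mu>0$, $\omega_n^\mu=\sqrt{\lambda_n/(1+\mu^2\lambda_n)}$. Short horizon kernel: for $\tau\in(0,\bar t^\mu)$ and $\xi,\zeta\in\mathscr{X}_1$, $$G_\tau^\mu(\xi,\zeta)=\sup_{w\in L_2([0,\tau];\mathscr{X}_1)}\left\{\left.\int_0^\tau V(x_s)-T^\mu(w_s)\,ds\ \right|\ x_s=\xi+\int_0^s w_\sigma\,d\sigma,\ x_\tau=\zeta\right\},$$ with $V(x)=\tfrac12\|x\|_1^2$ and $T^\mu(w)=\tfrac12\|w\|^2+\tfrac{\mu^2}2\|w\|_1^2$.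 In the paper this kernel is used through its quadratic representation $G_\tau^\mu(\xi,\zeta)=\tfrac12\langle\xi,\mathcal{P}_\tau^\mu\xi\rangle_1+\langle\xi,\mathcal{Q}_\tau^\mu\zeta\rangle_1+\tfrac12\langle\zeta,\mathcal{P}_\tau^\mu\zeta\rangle_1$, where $\mathcal{P}_\tau^\mu,\mathcal{Q}_\tau^\mu$ are diagonal in $\{\tilde\varphi_n\}$ with eigenvalues $-1/(\omega_n^\mu\tan(\omega_n^\mu\tau))$ and $1/(\omega_n^\mu\sin(\omega_n^\mu\tau))$. Longer horizons: $\Omega^\mu=\mathbb{R}_{>0}\setminus\{t_{n,j,k}^\mu\}_{n\in\mathbb{N}\cup\{\infty\},\,j,k\in\mathbb{N}}$, where $t_{n,j,k}^\mu=\frac{j}{k}\,\frac{\pi}{2}\,\frac1{\omega_n^\mu}$ for $n\in\mathbb{N}$ and $t_{\infty,j,k}^\mu=\frac jk\,\frac\pi2\,\mu$. For $s\in\Omega^\mu$ and $\xi,\zeta\in\mathscr{X}_1$, $$\widetilde{G}_s^\mu(\xi,\zeta)=\tfrac12\langle\xi,\widetilde{\mathcal{P}}_s^\mu\xi\rangle_1+\langle\xi,\widetilde{\mathcal{Q}}_s^\mu\zeta\rangle_1+\tfrac12\langle\zeta,\widetilde{\mathcal{P}}_s^\mu\zeta\rangle_1,$$ $$\widetilde{\mathcal{P}}_s^\mu\xi=\sum_{n=1}^\infty\frac{-1}{\omega_n^\mu\tan(\omega_n^\mu s)}\langle\xi,\tilde\varphi_n\rangle_1\tilde\varphi_n,\qquad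 \widetilde{\mathcal{Q}}_s^\mu\xi=\sum_{n=1}^\infty\frac{1}{\omega_n^\mu\sin(\omega_n^\mu s)}\langle\xi,\tilde\varphi_n\rangle_1\tilde\varphi_n.$$ Stat operation: for $F:\mathscr{Z}\to\mathbb{R}$ on a Hilbert space $\mathscr{Z}$ ($\mathscr{X}_1$ or a finite product of copies of it, with the product norm), $$\operatorname*{argstat}_{\zeta\in\mathscr{Z}}F(\zeta)=\left\{\zeta\in\mathscr{Z}\ \Big|\ 0=\lim_{y\to\zeta}\frac{|F(y)-F(\zeta)|}{\|y-\zeta\|}\right\},\qquad \operatorname*{stat}_{\zeta\in\mathscr{Z}}F(\zeta)=\left\{F(\bar\zeta)\ \Big|\ \bar\zeta\in\operatorname*{argstat}_{\zeta\in\mathscr{Z}}F(\zeta)\right\}.$$ An equation $a=\operatorname{stat}F$ with $a\in\mathbb{R}$ means that this set is the singleton $\{a\}$; the stat is achieved at $\bar\zeta$ if $\bar\zeta\in\operatorname{argstat}F$. *)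

theory Defs
  imports "HOL-Analysis.Analysis" "HOL-Library.Going_To_Filter"
begin

section \<open>Unbounded operators on a real Hilbert space\<close>

text \<open>
  An unbounded operator is a domain \<open>D\<close> together with a function \<open>A\<close> whose values outside \<open>D\<close>
  are irrelevant.
\<close>

definition adjoint_dom :: "'a::real_inner set \<Rightarrow> ('a \<Rightarrow> 'a) \<Rightarrow> 'a set" where
  "adjoint_dom D A = {y. \<exists>z. \<forall>x\<in>D. A x \<bullet> y = x \<bullet> z}"

definition densely_defined_op :: "'a::real_inner set \<Rightarrow> ('a \<Rightarrow> 'a) \<Rightarrow> bool" where
  "densely_defined_op D A \<longleftrightarrow> subspace D \<and> closure D = UNIV \<and>
     (\<forall>x\<in>D. \<forall>y\<in>D. A (x + y) = A x + A y) \<and> (\<forall>c. \<forall>x\<in>D. A (c *\<^sub>R x) = c *\<^sub>R A x)"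

definition self_adjoint_op :: "'a::real_inner set \<Rightarrow> ('a \<Rightarrow> 'a) \<Rightarrow> bool" where
  "self_adjoint_op D A \<longleftrightarrow> densely_defined_op D A \<and> adjoint_dom D A = D \<and>
     (\<forall>x\<in>D. \<forall>y\<in>D. A x \<bullet> y = x \<bullet> A y)"

definition positive_op :: "'a::real_inner set \<Rightarrow> ('a \<Rightarrow> 'a) \<Rightarrow> bool" where
  "positive_op D A \<longleftrightarrow> (\<forall>x\<in>D. x \<noteq> 0 \<longrightarrow> 0 < A x \<bullet> x)"

definition unbounded_op :: "'a::real_inner set \<Rightarrow> ('a \<Rightarrow> 'a) \<Rightarrow> bool" where
  "unbounded_op D A \<longleftrightarrow> (\<forall>C. \<exists>x\<in>D. C * norm x < norm (A x))"

definition has_compact_inverse :: "'a::real_inner set \<Rightarrow> ('a \<Rightarrow> 'a) \<Rightarrow> bool" where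
  "has_compact_inverse D A \<longleftrightarrow> bij_betw A D UNIV \<and> bounded_linear (inv_into D A) \<and>
     compact (closure (inv_into D A ` cball 0 1))"

text \<open>\<open>(E, S)\<close> is the positive self-adjoint square root of \<open>(D, A)\<close>, domains included.\<close>

definition is_sqrt_op :: "'a::real_inner set \<Rightarrow> ('a \<Rightarrow> 'a) \<Rightarrow> 'a set \<Rightarrow> ('a \<Rightarrow> 'a) \<Rightarrow> bool" where
  "is_sqrt_op E S D A \<longleftrightarrow> self_adjoint_op E S \<and> positive_op E S \<and>
     D = {x \<in> E. S x \<in> E} \<and> (\<forall>x\<in>D. S (S x) = A x)"

definition orthonormal_basis :: "(nat \<Rightarrow> 'a::real_inner) \<Rightarrow> bool" where
  "orthonormal_basis \<phi> \<longleftrightarrow>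
     (\<forall>m n. \<phi> m \<bullet> \<phi> n = (if m = n then 1 else 0)) \<and> closure (span (range \<phi>)) = UNIV"


section \<open>The energy space\<close>

text \<open>
  Below, \<open>X1\<close> and \<open>S\<close> are the domain and the action of the square root of the given operator;
  \<open>X1\<close> is a Hilbert space with the following inner product.
\<close>

definition inner1 :: "('a::real_inner \<Rightarrow> 'a) \<Rightarrow> 'a \<Rightarrow> 'a \<Rightarrow> real" where
  "inner1 S x y = S x \<bullet> S y"

definition norm1 :: "('a::real_inner \<Rightarrow> 'a) \<Rightarrow> 'a \<Rightarrow> real" where
  "norm1 S x = sqrt (inner1 S x x)"

definition dist1 :: "('a::real_inner \<Rightarrow> 'a) \<Rightarrow> 'a \<Rightarrow> 'a \<Rightarrow> real" where
  "dist1 S x y = norm1 S (x - y)"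

text \<open>Sum of a series with respect to convergence in the norm of \<open>X1\<close>.\<close>

definition suminf1 :: "'a::real_inner set \<Rightarrow> ('a \<Rightarrow> 'a) \<Rightarrow> (nat \<Rightarrow> 'a) \<Rightarrow> 'a" where
  "suminf1 X1 S f = (THE y. y \<in> X1 \<and> (\<lambda>N. dist1 S (\<Sum>n<N. f n) y) \<longlonglongrightarrow> 0)"

text \<open>
  The product of copies of \<open>X1\<close> indexed by \<open>I\<close>, and the distance of the product norm.
\<close>

definition prod_X1 :: "'a set \<Rightarrow> nat set \<Rightarrow> (nat \<Rightarrow> 'a) set" where
  "prod_X1 X1 I = (\<Pi>\<^sub>E i\<in>I. X1)"

definition prod_dist1 ::
    "('a::real_inner \<Rightarrow> 'a) \<Rightarrow> nat set \<Rightarrow> (nat \<Rightarrow> 'a) \<Rightarrow> (nat \<Rightarrow> 'a) \<Rightarrow> real" where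
  "prod_dist1 S I x y = L2_set (\<lambda>i. dist1 S (x i) (y i)) I"


section \<open>Stationary points and values\<close>

text \<open>
  \<open>Z\<close> is the carrier of the space and \<open>d y z\<close> the norm of \<open>y - z\<close>.  The filter is that of
  \<open>y\<close> tending to \<open>z\<close> within \<open>Z\<close>, with \<open>y \<noteq> z\<close>.
\<close>

definition argstat :: "'z set \<Rightarrow> ('z \<Rightarrow> 'z \<Rightarrow> real) \<Rightarrow> ('z \<Rightarrow> real) \<Rightarrow> 'z set" where
  "argstat Z d F =
     {z \<in> Z. ((\<lambda>y. \<bar>F y - F z\<bar> / d y z) \<longlongrightarrow> 0) ((\<lambda>y. d y z) going_to at_right 0 within Z)}"

definition stat :: "'z set \<Rightarrow> ('z \<Rightarrow> 'z \<Rightarrow> real) \<Rightarrow> ('z \<Rightarrow> real) \<Rightarrow> real set" where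
  "stat Z d F = F ` argstat Z d F"


section \<open>Short horizon kernel\<close>

definition potential :: "('a::real_inner \<Rightarrow> 'a) \<Rightarrow> 'a \<Rightarrow> real" where
  "potential S x = (norm1 S x)\<^sup>2 / 2"

definition kinetic :: "('a::real_inner \<Rightarrow> 'a) \<Rightarrow> real \<Rightarrow> 'a \<Rightarrow> real" where
  "kinetic S \<mu> w = (norm w)\<^sup>2 / 2 + \<mu>\<^sup>2 / 2 * (norm1 S w)\<^sup>2"

text \<open>
  Square integrable functions from \<open>{0..\<tau>}\<close> to \<open>X1\<close>.  As \<open>S\<close> is an isometric isomorphism from
  \<open>X1\<close> onto the ambient space, \<open>w\<close> is measurable as an \<open>X1\<close>-valued function iff \<open>S \<circ> w\<close> is
  measurable.
\<close>

definition L2_X1 ::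
    "'a::{real_inner,banach,second_countable_topology} set \<Rightarrow> ('a \<Rightarrow> 'a) \<Rightarrow> real \<Rightarrow> (real \<Rightarrow> 'a) set" where
  "L2_X1 X1 S \<tau> = {w. (\<forall>s\<in>{0..\<tau>}. w s \<in> X1) \<and>
     set_borel_measurable lborel {0..\<tau>} (\<lambda>s. S (w s)) \<and>
     set_integrable lborel {0..\<tau>} (\<lambda>s. (norm1 S (w s))\<^sup>2)}"

text \<open>
  The Bochner integral is taken in the ambient space; for \<open>w\<close> in \<open>L2_X1\<close> it is the Bochner
  integral in \<open>X1\<close>, because the inclusion of \<open>X1\<close> is continuous.
\<close>

definition trajectory ::
    "'a::{real_inner,banach,second_countable_topology} \<Rightarrow> (real \<Rightarrow> 'a) \<Rightarrow> real \<Rightarrow> 'a" where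
  "trajectory \<xi> w s = \<xi> + (LINT \<sigma>:{0..s}|lborel. w \<sigma>)"

definition action ::
    "('a::{real_inner,banach,second_countable_topology} \<Rightarrow> 'a) \<Rightarrow> real \<Rightarrow> real \<Rightarrow> 'a \<Rightarrow> (real \<Rightarrow> 'a) \<Rightarrow> real" where
  "action S \<mu> \<tau> \<xi> w =
     (LINT s:{0..\<tau>}|lborel. potential S (trajectory \<xi> w s) - kinetic S \<mu> (w s))"

text \<open>
  The supremum is real-valued: for the horizons \<open>0 < \<tau> < \<mu> * sqrt 2\<close> in use it is finite.
\<close>

definition G_short ::
    "'a::{real_inner,banach,second_countable_topology} set \<Rightarrow> ('a \<Rightarrow> 'a) \<Rightarrow> real \<Rightarrow> real \<Rightarrow> 'a \<Rightarrow> 'a \<Rightarrow> real" where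
  "G_short X1 S \<mu> \<tau> \<xi> \<zeta> =
     Sup {action S \<mu> \<tau> \<xi> w | w. w \<in> L2_X1 X1 S \<tau> \<and> trajectory \<xi> w \<tau> = \<zeta>}"


section \<open>Longer horizons\<close>

text \<open>
  The eigenvalues \<open>lam\<close> and eigenvectors \<open>\<phi>\<close> are indexed from \<open>0\<close>.
\<close>

definition freq :: "(nat \<Rightarrow> real) \<Rightarrow> real \<Rightarrow> nat \<Rightarrow> real" where
  "freq lam \<mu> n = sqrt (lam n / (1 + \<mu>\<^sup>2 * lam n))"

definition \<Omega> :: "(nat \<Rightarrow> real) \<Rightarrow> real \<Rightarrow> real set" where
  "\<Omega> lam \<mu> = {0<..} -
     ({real j / real k * (pi / 2) * (1 / freq lam \<mu> n) | n j k. 1 \<le> j \<and> 1 \<le> k} \<union>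
      {real j / real k * (pi / 2) * \<mu> | j k. 1 \<le> j \<and> 1 \<le> k})"

definition phi1 :: "(nat \<Rightarrow> 'a::real_inner) \<Rightarrow> (nat \<Rightarrow> real) \<Rightarrow> nat \<Rightarrow> 'a" where
  "phi1 \<phi> lam n = (1 / sqrt (lam n)) *\<^sub>R \<phi> n"

definition P_op ::
    "'a::real_inner set \<Rightarrow> ('a \<Rightarrow> 'a) \<Rightarrow> (nat \<Rightarrow> 'a) \<Rightarrow> (nat \<Rightarrow> real) \<Rightarrow> real \<Rightarrow> real \<Rightarrow> 'a \<Rightarrow> 'a" where
  "P_op X1 S \<phi> lam \<mu> s \<xi> = suminf1 X1 S (\<lambda>n.
     (-1 / (freq lam \<mu> n * tan (freq lam \<mu> n * s)) * inner1 S \<xi> (phi1 \<phi> lam n)) *\<^sub>R phi1 \<phi> lam n)"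

definition Q_op ::
    "'a::real_inner set \<Rightarrow> ('a \<Rightarrow> 'a) \<Rightarrow> (nat \<Rightarrow> 'a) \<Rightarrow> (nat \<Rightarrow> real) \<Rightarrow> real \<Rightarrow> real \<Rightarrow> 'a \<Rightarrow> 'a" where
  "Q_op X1 S \<phi> lam \<mu> s \<xi> = suminf1 X1 S (\<lambda>n.
     (1 / (freq lam \<mu> n * sin (freq lam \<mu> n * s)) * inner1 S \<xi> (phi1 \<phi> lam n)) *\<^sub>R phi1 \<phi> lam n)"

definition G_long ::
    "'a::real_inner set \<Rightarrow> ('a \<Rightarrow> 'a) \<Rightarrow> (nat \<Rightarrow> 'a) \<Rightarrow> (nat \<Rightarrow> real) \<Rightarrow> real \<Rightarrow> real \<Rightarrow> 'a \<Rightarrow> 'a \<Rightarrow> real" where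
  "G_long X1 S \<phi> lam \<mu> s \<xi> \<zeta> =
     inner1 S \<xi> (P_op X1 S \<phi> lam \<mu> s \<xi>) / 2 + inner1 S \<xi> (Q_op X1 S \<phi> lam \<mu> s \<zeta>)
     + inner1 S \<zeta> (P_op X1 S \<phi> lam \<mu> s \<zeta>) / 2"

end

theory Submission
  imports Defs
begin

text \<open>
  Everything is diagonal.  As \<open>S\<close> is an isometry of the energy space onto the ambient Hilbert space,
  a point of \<open>X1\<close> is a square summable sequence of coordinates \<open>S x \<bullet> \<phi> m\<close>, and the action is a sum
  of actions of one-dimensional harmonic oscillators with frequencies \<open>freq lam \<mu> m\<close>, because
  \<open>1 / (freq lam \<mu> m)\<^sup>2 = 1 / lam m + \<mu>\<^sup>2\<close> collects both terms of the kinetic energy.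

  For one oscillator and a horizon below \<open>\<mu> * sqrt 2\<close>, the classical path maximizes the action: the
  deviation \<open>h\<close> of another path with the same end points contributes only its own action, which is
  nonpositive by Poincare's inequality (\<open>osc_action_le\<close>).  The value at the classical path is the
  quadratic form whose coefficients are those of the horizon operators.  Summing over the modes
  (\<open>action_sums\<close>, by dominated convergence) and assembling the classical paths of all modes into one
  admissible trajectory (\<open>optimal_velocity\<close>) shows that the short horizon kernel is the supposed
  quadratic form (\<open>G_short_eq_G_long\<close>).

  The functionals whose stationary points are sought are therefore quadratic, with coefficients
  bounded uniformly in the mode; the bounds hold because the horizon is nonresonant: the frequencies
  converge to \<open>1 / \<mu>\<close>, and \<open>\<Omega>\<close> keeps all the sines involved, and their limit, away from zero.  For
  such functionals a point is stationary iff every partial derivative in every mode vanishes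
  (\<open>argstat_modewise\<close>).  The derivatives of the kernel of one mode are the end velocities of the
  classical path (\<open>kernel_gradient_on_path\<close>), so the vanishing of the derivatives says that the pieces
  fit together smoothly; hence the only stationary point samples, mode by mode, the classical path
  over the whole horizon, even though on long horizons this path need not be a maximizer.
  The stationary value telescopes to the boundary term of that path, which is the kernel of the
  whole horizon (\<open>two_leg_stationary\<close> and \<open>chain_stationary\<close>).
\<close>

section \<open>Coordinates with respect to an orthonormal basis\<close>

locale hilbert_basis =
  fixes \<phi> :: "nat \<Rightarrow> 'a::{real_inner,banach}"
  assumes onb: "orthonormal_basis \<phi>"
begin

lemma basis_inner: "\<phi> m \<bullet> \<phi> n = (if m = n then 1 else 0)"
  using onb by (simp add: orthonormal_basis_def)

lemma inner_sum_basis: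
  assumes "finite A"
  shows "(\<Sum>m\<in>A. f m *\<^sub>R \<phi> m) \<bullet> \<phi> k = (if k \<in> A then f k else 0)"
proof -
  have "(\<Sum>m\<in>A. f m *\<^sub>R \<phi> m) \<bullet> \<phi> k = (\<Sum>m\<in>A. if m = k then f m else 0)"
    unfolding inner_sum_left by (intro sum.cong) (auto simp: basis_inner)
  then show ?thesis using assms by simp
qed

lemma norm_sum_basis:
  assumes "finite A"
  shows "(norm (\<Sum>m\<in>A. f m *\<^sub>R \<phi> m))\<^sup>2 = (\<Sum>m\<in>A. (f m)\<^sup>2)"
proof -
  have "(norm (\<Sum>m\<in>A. f m *\<^sub>R \<phi> m))\<^sup>2 = (\<Sum>k\<in>A. f k * ((\<Sum>m\<in>A. f m *\<^sub>R \<phi> m) \<bullet> \<phi> k))"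
    unfolding power2_norm_eq_inner by (subst inner_sum_right) simp
  also have "\<dots> = (\<Sum>k\<in>A. (f k)\<^sup>2)"
    unfolding inner_sum_basis[OF assms] by (intro sum.cong) (auto simp: power2_eq_square)
  finally show ?thesis .
qed

lemma norm_residual_le: "norm (x - (\<Sum>m<N. (x \<bullet> \<phi> m) *\<^sub>R \<phi> m)) \<le> norm x"
proof -
  let ?p = "\<Sum>m<N. (x \<bullet> \<phi> m) *\<^sub>R \<phi> m"
  have "x \<bullet> ?p = (norm ?p)\<^sup>2"
    unfolding norm_sum_basis[OF finite_lessThan] inner_sum_right by (simp add: power2_eq_square)
  then have "(norm (x - ?p))\<^sup>2 = (norm x)\<^sup>2 - (norm ?p)\<^sup>2"
    unfolding power2_norm_eq_inner by (simp add: inner_diff_left inner_diff_right inner_commute)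
  then have "(norm (x - ?p))\<^sup>2 \<le> (norm x)\<^sup>2" by simp
  then show ?thesis by (rule power2_le_imp_le) simp
qed

text \<open>
  The vectors that are the sum of their Fourier series form a subspace containing the basis, and
  the residuals of the partial sums are contractions uniformly in the length, so that the property
  passes to the closure.
\<close>

lemma fourier_sums: "(\<lambda>m. (x \<bullet> \<phi> m) *\<^sub>R \<phi> m) sums x"
proof -
  let ?T = "{x. (\<lambda>m. (x \<bullet> \<phi> m) *\<^sub>R \<phi> m) sums x}"
  have "subspace ?T"
    unfolding subspace_def
  proof (intro conjI ballI allI)
    show "0 \<in> ?T" by simp
  next
    fix x y assume "x \<in> ?T" "y \<in> ?T"
    then show "x + y \<in> ?T" by (auto simp: inner_add_left scaleR_add_left intro!: sums_add)
  next
    fix c x assume "x \<in> ?T"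
    then have "(\<lambda>m. c *\<^sub>R ((x \<bullet> \<phi> m) *\<^sub>R \<phi> m)) sums (c *\<^sub>R x)" by (intro sums_scaleR_right) simp
    then show "c *\<^sub>R x \<in> ?T" by simp
  qed
  moreover have "\<phi> k \<in> ?T" for k
  proof -
    have "(\<lambda>m. if m = k then \<phi> m else 0) sums \<phi> k" by (rule sums_single)
    moreover have "(\<lambda>m. if m = k then \<phi> m else 0) = (\<lambda>m. (\<phi> k \<bullet> \<phi> m) *\<^sub>R \<phi> m)"
      by (auto simp: basis_inner)
    ultimately show ?thesis by simp
  qed
  ultimately have span: "span (range \<phi>) \<subseteq> ?T" by (intro span_minimal) auto
  have "\<exists>N0. \<forall>N\<ge>N0. norm ((\<Sum>m<N. (x \<bullet> \<phi> m) *\<^sub>R \<phi> m) - x) < e" if "e > 0" for e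
  proof -
    have "x \<in> closure (span (range \<phi>))" using onb by (simp add: orthonormal_basis_def)
    then obtain y where y: "y \<in> span (range \<phi>)" "dist y x < e / 2"
      using \<open>e > 0\<close> by (meson closure_approachable half_gt_zero)
    then have "(\<lambda>m. (y \<bullet> \<phi> m) *\<^sub>R \<phi> m) sums y" using span by auto
    then obtain N0 where N0: "\<forall>N\<ge>N0. norm ((\<Sum>m<N. (y \<bullet> \<phi> m) *\<^sub>R \<phi> m) - y) < e / 2"
      unfolding sums_def LIMSEQ_iff using \<open>e > 0\<close> by (meson half_gt_zero)
    have "norm ((\<Sum>m<N. (x \<bullet> \<phi> m) *\<^sub>R \<phi> m) - x) < e" if "N \<ge> N0" for N
    proof -
      let ?d = "x - y"
      have "(\<Sum>m<N. (x \<bullet> \<phi> m) *\<^sub>R \<phi> m) - x = ((\<Sum>m<N. (y \<bullet> \<phi> m) *\<^sub>R \<phi> m) - y)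
          - (?d - (\<Sum>m<N. (?d \<bullet> \<phi> m) *\<^sub>R \<phi> m))"
        by (simp add: inner_diff_left scaleR_diff_left sum_subtractf)
      also have "norm \<dots> \<le> norm ((\<Sum>m<N. (y \<bullet> \<phi> m) *\<^sub>R \<phi> m) - y)
          + norm (?d - (\<Sum>m<N. (?d \<bullet> \<phi> m) *\<^sub>R \<phi> m))" by (rule norm_triangle_ineq4)
      also have "\<dots> < e / 2 + e / 2"
        using norm_residual_le[of ?d N] N0 that y(2)
        by (intro add_less_le_mono) (auto simp: dist_norm norm_minus_commute)
      finally show ?thesis by simp
    qed
    then show ?thesis by blast
  qed
  then show ?thesis unfolding sums_def LIMSEQ_iff by simp
qed

lemma parseval: "(\<lambda>m. (x \<bullet> \<phi> m) * (y \<bullet> \<phi> m)) sums (x \<bullet> y)"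
  using bounded_linear.sums[OF bounded_linear_inner_left fourier_sums, of x y]
  by (simp add: inner_commute mult.commute)

lemma parseval_norm: "(\<lambda>m. (x \<bullet> \<phi> m)\<^sup>2) sums (norm x)\<^sup>2"
  using parseval[of x x] by (simp add: power2_eq_square norm_eq_sqrt_inner)

lemma bessel: "finite A \<Longrightarrow> (\<Sum>m\<in>A. (x \<bullet> \<phi> m)\<^sup>2) \<le> (norm x)\<^sup>2"
  using parseval_norm[of x] by (metis sum_le_suminf sums_iff zero_le_power2)

lemma basis_coord_eqI: "(\<And>m. x \<bullet> \<phi> m = y \<bullet> \<phi> m) \<Longrightarrow> x = y"
  using fourier_sums[of x] fourier_sums[of y] by (auto dest: sums_unique2)

lemma sums_inner_basis: "(\<lambda>m. f m *\<^sub>R \<phi> m) sums x \<Longrightarrow> x \<bullet> \<phi> k = f k"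
proof -
  assume "(\<lambda>m. f m *\<^sub>R \<phi> m) sums x"
  then have "(\<lambda>m. (f m *\<^sub>R \<phi> m) \<bullet> \<phi> k) sums (x \<bullet> \<phi> k)"
    by (rule bounded_linear.sums[OF bounded_linear_inner_left])
  moreover have "(\<lambda>m. (f m *\<^sub>R \<phi> m) \<bullet> \<phi> k) = (\<lambda>m. if m = k then f m else 0)"
    by (auto simp: basis_inner)
  ultimately show ?thesis using sums_single[of k f] by (metis sums_unique2)
qed

lemma summable_basis_series:
  assumes "summable (\<lambda>m. (f m)\<^sup>2)"
  shows "summable (\<lambda>m. f m *\<^sub>R \<phi> m)"
  unfolding summable_Cauchy
proof (intro allI impI)
  fix e :: real assume "e > 0"
  then obtain N where N: "\<forall>m\<ge>N. \<forall>n. norm (\<Sum>k\<in>{m..<n}. (f k)\<^sup>2) < e\<^sup>2"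
    using assms unfolding summable_Cauchy by (meson zero_less_power)
  have "norm (\<Sum>k\<in>{m..<n}. f k *\<^sub>R \<phi> k) < e" if "m \<ge> N" for m n
  proof -
    have "(norm (\<Sum>k\<in>{m..<n}. f k *\<^sub>R \<phi> k))\<^sup>2 < e\<^sup>2"
      using N that by (simp add: norm_sum_basis abs_of_nonneg sum_nonneg)
    then show ?thesis using \<open>e > 0\<close> by (meson less_imp_le power2_less_imp_less)
  qed
  then show "\<exists>N. \<forall>m\<ge>N. \<forall>n. norm (\<Sum>k\<in>{m..<n}. f k *\<^sub>R \<phi> k) < e" by blast
qed

lemma riesz_fischer:
  assumes "summable (\<lambda>m. (f m)\<^sup>2)"
  obtains x where "\<And>m. x \<bullet> \<phi> m = f m"
  using summable_basis_series[OF assms] sums_inner_basis summable_sums by blast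

end

section \<open>The energy space in coordinates\<close>

locale energy_space = hilbert_basis \<phi>
  for \<phi> :: "nat \<Rightarrow> 'a::{real_inner,banach,second_countable_topology}" +
  fixes X1 :: "'a set" and S :: "'a \<Rightarrow> 'a" and lam :: "nat \<Rightarrow> real"
  assumes X1_subspace: "subspace X1"
    and S_add: "x \<in> X1 \<Longrightarrow> y \<in> X1 \<Longrightarrow> S (x + y) = S x + S y"
    and S_scale: "x \<in> X1 \<Longrightarrow> S (c *\<^sub>R x) = c *\<^sub>R S x"
    and S_bij: "bij_betw S X1 UNIV"
    and S_coord: "x \<in> X1 \<Longrightarrow> S x \<bullet> \<phi> m = sqrt (lam m) * (x \<bullet> \<phi> m)"
    and lam_0: "0 < lam 0" and lam_mono: "mono lam"
begin

abbreviation coord :: "'a \<Rightarrow> nat \<Rightarrow> real" where "coord x m \<equiv> S x \<bullet> \<phi> m"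

lemma lam_ge: "lam 0 \<le> lam m" using lam_mono by (simp add: monoD)

lemma lam_pos: "0 < lam m" using lam_ge[of m] lam_0 by linarith

lemma S_diff: "x \<in> X1 \<Longrightarrow> y \<in> X1 \<Longrightarrow> S (x - y) = S x - S y"
  using S_add[of x "(-1) *\<^sub>R y"] S_scale[of y "-1"] X1_subspace
  by (simp add: subspace_neg)

lemma coord_eqI: "x \<in> X1 \<Longrightarrow> y \<in> X1 \<Longrightarrow> (\<And>m. coord x m = coord y m) \<Longrightarrow> x = y"
  using basis_coord_eqI S_bij by (metis bij_betw_imp_inj_on inj_onD)

lemma coord_exists:
  assumes "summable (\<lambda>m. (f m)\<^sup>2)"
  obtains x where "x \<in> X1" "\<And>m. coord x m = f m"
proof -
  obtain u where "\<And>m. u \<bullet> \<phi> m = f m" using riesz_fischer[OF assms] by blast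
  moreover obtain x where "x \<in> X1" "S x = u"
    using S_bij by (metis UNIV_I bij_betw_imp_surj_on imageE)
  ultimately show thesis using that by blast
qed

lemma coord_summable: "summable (\<lambda>m. (coord x m)\<^sup>2)"
  using parseval_norm sums_summable by blast

lemma inner1_sums: "(\<lambda>m. coord x m * coord y m) sums inner1 S x y"
  unfolding inner1_def by (rule parseval)

lemma dist1_eq: "x \<in> X1 \<Longrightarrow> y \<in> X1 \<Longrightarrow> dist1 S x y = norm (S x - S y)"
  by (simp add: dist1_def norm1_def inner1_def S_diff norm_eq_sqrt_inner)

lemma dist1_sums:
  assumes "x \<in> X1" "y \<in> X1"
  shows "(\<lambda>m. (coord x m - coord y m)\<^sup>2) sums (dist1 S x y)\<^sup>2"
  using parseval_norm[of "S x - S y"] assms by (simp add: dist1_eq inner_diff_left)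

text \<open>
  Membership in the domain follows from the surjectivity of \<open>S\<close>: a preimage of \<open>\<phi> m\<close> has the
  coordinates of the normalized eigenvector.
\<close>

lemma S_phi1: "phi1 \<phi> lam m \<in> X1 \<and> S (phi1 \<phi> lam m) = \<phi> m"
proof -
  obtain z where z: "z \<in> X1" "S z = \<phi> m"
    using S_bij by (metis UNIV_I bij_betw_imp_surj_on imageE)
  have "z = phi1 \<phi> lam m"
  proof (rule basis_coord_eqI)
    fix k
    have "sqrt (lam k) * (z \<bullet> \<phi> k) = \<phi> m \<bullet> \<phi> k" using S_coord[OF z(1), of k] z(2) by simp
    moreover have "sqrt (lam k) > 0" using lam_pos[of k] by simp
    ultimately show "z \<bullet> \<phi> k = phi1 \<phi> lam m \<bullet> \<phi> k"
      by (auto simp: phi1_def basis_inner field_simps)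
  qed
  with z show ?thesis by simp
qed

lemma inner1_phi1: "inner1 S x (phi1 \<phi> lam m) = coord x m"
  by (simp add: inner1_def S_phi1)

lemma sum_phi1: 
  assumes "finite A"
  shows "(\<Sum>m\<in>A. f m *\<^sub>R phi1 \<phi> lam m) \<in> X1 \<and>
    S (\<Sum>m\<in>A. f m *\<^sub>R phi1 \<phi> lam m) = (\<Sum>m\<in>A. f m *\<^sub>R \<phi> m)"
  using assms
proof (induction A)
  case empty
  then show ?case using X1_subspace S_scale[of 0 0] by (simp add: subspace_0)
next
  case (insert a A)
  then show ?case using X1_subspace
    by (simp add: S_add S_scale S_phi1 subspace_add subspace_scale)
qed

text \<open>
  \<open>S\<close> carries convergence in the energy space to convergence in the ambient space, and it is
  injective; so the series converges to exactly one point.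
\<close>

lemma suminf1_coord:
  assumes "summable (\<lambda>m. (f m)\<^sup>2)"
  shows "suminf1 X1 S (\<lambda>m. f m *\<^sub>R phi1 \<phi> lam m) \<in> X1"
    and "coord (suminf1 X1 S (\<lambda>m. f m *\<^sub>R phi1 \<phi> lam m)) k = f k"
proof -
  have lim: "(\<lambda>N. dist1 S (\<Sum>n<N. f n *\<^sub>R phi1 \<phi> lam n) y) \<longlonglongrightarrow> 0 \<longleftrightarrow> (\<lambda>m. f m *\<^sub>R \<phi> m) sums S y"
    if "y \<in> X1" for y
    using that by (simp add: dist1_eq sum_phi1 sums_def tendsto_norm_zero_iff LIM_zero_iff)
  obtain y where y: "y \<in> X1" "\<And>m. coord y m = f m" using coord_exists[OF assms] by blast
  have "suminf1 X1 S (\<lambda>m. f m *\<^sub>R phi1 \<phi> lam m) = y"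
    unfolding suminf1_def
  proof (rule the_equality)
    show "y \<in> X1 \<and> (\<lambda>N. dist1 S (\<Sum>n<N. f n *\<^sub>R phi1 \<phi> lam n) y) \<longlonglongrightarrow> 0"
      using fourier_sums[of "S y"] y lim by simp
  next
    fix z assume "z \<in> X1 \<and> (\<lambda>N. dist1 S (\<Sum>n<N. f n *\<^sub>R phi1 \<phi> lam n) z) \<longlonglongrightarrow> 0"
    then show "z = y" using lim sums_inner_basis y by (metis coord_eqI)
  qed
  then show "suminf1 X1 S (\<lambda>m. f m *\<^sub>R phi1 \<phi> lam m) \<in> X1"
    and "coord (suminf1 X1 S (\<lambda>m. f m *\<^sub>R phi1 \<phi> lam m)) k = f k" using y by simp_all
qed

lemma summable_bounded_mult:
  assumes "\<And>m. \<bar>p m\<bar> \<le> K"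
  shows "summable (\<lambda>m. (p m * coord x m)\<^sup>2)"
proof (rule summable_comparison_test')
  show "summable (\<lambda>m. K\<^sup>2 * (coord x m)\<^sup>2)" by (intro summable_mult coord_summable)
  fix m :: nat
  show "norm ((p m * coord x m)\<^sup>2) \<le> K\<^sup>2 * (coord x m)\<^sup>2"
    using assms[of m] by (simp add: power_mult_distrib mult_right_mono abs_le_square_iff[symmetric])
qed

end

section \<open>Stationary points of functionals that split into modes\<close>

lemma argstat_iff:
  assumes "\<And>y z. y \<in> Z \<Longrightarrow> z \<in> Z \<Longrightarrow> 0 \<le> d y z"
  shows "z \<in> argstat Z d F \<longleftrightarrow> z \<in> Z \<and>
    (\<forall>e>0. \<exists>\<delta>>0. \<forall>y\<in>Z. 0 < d y z \<and> d y z < \<delta> \<longrightarrow> \<bar>F y - F z\<bar> < e * d y z)"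
proof -
  have "((\<lambda>y. \<bar>F y - F z\<bar> / d y z) \<longlongrightarrow> 0) ((\<lambda>y. d y z) going_to at_right 0 within Z) \<longleftrightarrow>
    (\<forall>e>0. \<exists>\<delta>>0. \<forall>y\<in>Z. 0 < d y z \<and> d y z < \<delta> \<longrightarrow> \<bar>F y - F z\<bar> / d y z < e)" if "z \<in> Z"
    unfolding tendsto_iff going_to_within_def eventually_inf_principal eventually_filtercomap
      eventually_at_right_field
  proof (intro all_cong1 imp_cong refl iffI)
    fix e :: real
    assume "\<exists>Q. (\<exists>b>0. \<forall>x>0. x < b \<longrightarrow> Q x) \<and> (\<forall>y. Q (d y z) \<longrightarrow> y \<in> Z \<longrightarrow> dist (\<bar>F y - F z\<bar> / d y z) 0 < e)"
    then show "\<exists>\<delta>>0. \<forall>y\<in>Z. 0 < d y z \<and> d y z < \<delta> \<longrightarrow> \<bar>F y - F z\<bar> / d y z < e"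
      using assms[OF _ that] by (metis abs_abs abs_divide abs_of_nonneg dist_0_norm dist_commute real_norm_def)
  next
    fix e :: real
    assume "\<exists>\<delta>>0. \<forall>y\<in>Z. 0 < d y z \<and> d y z < \<delta> \<longrightarrow> \<bar>F y - F z\<bar> / d y z < e"
    then obtain \<delta> where "\<delta> > 0" "\<And>y. y\<in>Z \<Longrightarrow> 0 < d y z \<and> d y z < \<delta> \<Longrightarrow> \<bar>F y - F z\<bar> / d y z < e" by blast
    then show "\<exists>Q. (\<exists>b>0. \<forall>x>0. x < b \<longrightarrow> Q x) \<and> (\<forall>y. Q (d y z) \<longrightarrow> y \<in> Z \<longrightarrow> dist (\<bar>F y - F z\<bar> / d y z) 0 < e)"
      by (intro exI[of _ "\<lambda>x. 0 < x \<and> x < \<delta>"]) (auto simp: dist_norm)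
  qed
  then show ?thesis by (auto simp: argstat_def divide_simps)
qed

text \<open>
  Quadratic remainders that are uniform over the modes make the vanishing of all the partial
  derivatives sufficient; moving a single coordinate of a single mode makes it necessary.
\<close>

lemma argstat_modewise:
  fixes cc :: "'z \<Rightarrow> nat \<Rightarrow> 'i \<Rightarrow> real"
  assumes I: "finite I"
    and d_nonneg: "\<And>y z. y \<in> Z \<Longrightarrow> z \<in> Z \<Longrightarrow> 0 \<le> d y z"
    and d: "\<And>y z. y \<in> Z \<Longrightarrow> z \<in> Z \<Longrightarrow> (\<lambda>m. \<Sum>i\<in>I. (cc y m i - cc z m i)\<^sup>2) sums (d y z)\<^sup>2"
    and F: "\<And>y. y \<in> Z \<Longrightarrow> (\<lambda>m. q m (cc y m)) sums F y"
    and taylor: "\<And>m x y. \<bar>q m y - q m x - (\<Sum>i\<in>I. D m x i * (y i - x i))\<bar>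
                   \<le> C * (\<Sum>i\<in>I. (y i - x i)\<^sup>2)"
    and bump: "\<And>z m i e. z \<in> Z \<Longrightarrow> i \<in> I \<Longrightarrow>
                 \<exists>y\<in>Z. \<forall>m' i'. cc y m' i' = cc z m' i' + (if m' = m \<and> i' = i then e else 0)"
  shows "argstat Z d F = {z \<in> Z. \<forall>m. \<forall>i\<in>I. D m (cc z m) i = 0}"
proof -
  have iff: "z \<in> argstat Z d F \<longleftrightarrow> z \<in> Z \<and>
    (\<forall>e>0. \<exists>\<delta>>0. \<forall>y\<in>Z. 0 < d y z \<and> d y z < \<delta> \<longrightarrow> \<bar>F y - F z\<bar> < e * d y z)" for z
    by (rule argstat_iff) (rule d_nonneg)
  have "z \<in> Z \<and> (\<forall>m. \<forall>i\<in>I. D m (cc z m) i = 0)" if "z \<in> argstat Z d F" for z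
  proof -
    from that have z: "z \<in> Z" and lim: "\<And>e. e > 0 \<Longrightarrow>
        \<exists>\<delta>>0. \<forall>y\<in>Z. 0 < d y z \<and> d y z < \<delta> \<longrightarrow> \<bar>F y - F z\<bar> < e * d y z"
      unfolding iff by blast+
    have "D m (cc z m) i = 0" if i: "i \<in> I" for m i
    proof (rule ccontr)
      assume nz: "D m (cc z m) i \<noteq> 0"
      let ?g = "D m (cc z m) i"
      obtain \<delta> where \<delta>: "\<delta> > 0"
        "\<And>y. y \<in> Z \<Longrightarrow> 0 < d y z \<Longrightarrow> d y z < \<delta> \<Longrightarrow> \<bar>F y - F z\<bar> < \<bar>?g\<bar> / 2 * d y z"
        using lim[of "\<bar>?g\<bar> / 2"] nz by auto
      \<comment> \<open>small enough that the remainder \<open>C * e\<^sup>2\<close> is at most half of the linear term\<close>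
      define e where "e = min (\<delta> / 2) (\<bar>?g\<bar> / (2 * (\<bar>C\<bar> + 1)))"
      have "0 < \<bar>?g\<bar> / (2 * (\<bar>C\<bar> + 1))" using nz by (intro divide_pos_pos) auto
      then have e: "e > 0" "e < \<delta>" using \<delta>(1) by (auto simp: e_def min_less_iff_disj)
      have "e * (2 * (\<bar>C\<bar> + 1)) \<le> \<bar>?g\<bar>"
        by (subst pos_le_divide_eq[symmetric]) (auto simp: e_def)
      then have "(\<bar>C\<bar> + 1) * e \<le> \<bar>?g\<bar> / 2" by (simp add: algebra_simps)
      moreover have "C * e \<le> (\<bar>C\<bar> + 1) * e" using e(1) by (intro mult_right_mono) auto
      ultimately have Ce: "C * e \<le> \<bar>?g\<bar> / 2" by linarith
      obtain y where y: "y \<in> Z"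
        "\<And>m' i'. cc y m' i' = cc z m' i' + (if m' = m \<and> i' = i then e else 0)"
        using bump[OF z i, of m e] by auto
      have row: "cc y m' = cc z m'" if "m' \<noteq> m" for m' using y(2) that by (intro ext) simp
      have *: "(\<Sum>i'\<in>I. f i' * (cc y m i' - cc z m i')) = f i * e" for f
      proof -
        have "(\<Sum>i'\<in>I. f i' * (cc y m i' - cc z m i')) = (\<Sum>i'\<in>I. if i' = i then f i * e else 0)"
          by (intro sum.cong) (auto simp: y(2))
        then show ?thesis using I i by simp
      qed
      have **: "(\<Sum>i'\<in>I. (cc y m i' - cc z m i')\<^sup>2) = e\<^sup>2"
      proof -
        have "(\<Sum>i'\<in>I. (cc y m i' - cc z m i')\<^sup>2) = (\<Sum>i'\<in>I. if i' = i then e\<^sup>2 else 0)"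
          by (intro sum.cong) (auto simp: y(2))
        then show ?thesis using I i by simp
      qed
      have "(\<lambda>m'. \<Sum>i'\<in>I. (cc y m' i' - cc z m' i')\<^sup>2) = (\<lambda>m'. if m' = m then e\<^sup>2 else 0)"
        using ** row by auto
      then have "(d y z)\<^sup>2 = e\<^sup>2" using d[OF y(1) z] sums_single[of m "\<lambda>_. e\<^sup>2"]
        by (metis (no_types, lifting) sums_unique2)
      then have dyz: "d y z = e" using e(1) d_nonneg[OF y(1) z] by (simp add: power2_eq_iff_nonneg)
      have "(\<lambda>m'. q m' (cc y m') - q m' (cc z m')) = (\<lambda>m'. if m' = m then q m (cc y m) - q m (cc z m) else 0)"
        using row by auto
      then have Fd: "F y - F z = q m (cc y m) - q m (cc z m)"
        using sums_diff[OF F[OF y(1)] F[OF z]] sums_single[of m "\<lambda>_. q m (cc y m) - q m (cc z m)"]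
        by (metis (no_types, lifting) sums_unique2)
      have "\<bar>F y - F z - ?g * e\<bar> \<le> C * e\<^sup>2"
        using taylor[of m "cc y m" "cc z m"] unfolding * ** Fd .
      moreover have "\<bar>?g * e\<bar> = \<bar>?g\<bar> * e" using e(1) by (simp add: abs_mult)
      moreover have "C * e\<^sup>2 \<le> \<bar>?g\<bar> / 2 * e"
        using mult_right_mono[OF Ce, of e] e(1) by (simp add: power2_eq_square)
      ultimately have "\<bar>F y - F z\<bar> \<ge> \<bar>?g\<bar> / 2 * e" by linarith
      then show False using \<delta>(2)[OF y(1)] dyz e by auto
    qed
    then show ?thesis using z by simp
  qed
  moreover have "z \<in> argstat Z d F" if "z \<in> Z \<and> (\<forall>m. \<forall>i\<in>I. D m (cc z m) i = 0)" for z
  proof -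
    from that have z: "z \<in> Z" and crit: "\<And>m i. i \<in> I \<Longrightarrow> D m (cc z m) i = 0" by auto
    have le: "\<bar>F y - F z\<bar> \<le> C * (d y z)\<^sup>2" if y: "y \<in> Z" for y
    proof -
      have s: "(\<lambda>m. q m (cc y m) - q m (cc z m)) sums (F y - F z)"
        using F y z by (intro sums_diff) auto
      have t: "(\<lambda>m. C * (\<Sum>i\<in>I. (cc y m i - cc z m i)\<^sup>2)) sums (C * (d y z)\<^sup>2)"
        using d y z by (intro sums_mult) auto
      have b: "\<bar>q m (cc y m) - q m (cc z m)\<bar> \<le> C * (\<Sum>i\<in>I. (cc y m i - cc z m i)\<^sup>2)" for m
        using taylor[of m "cc y m" "cc z m"] crit by simp
      have "F y - F z \<le> C * (d y z)\<^sup>2" using b by (intro sums_le[OF _ s t]) (simp add: abs_le_iff)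
      moreover have "- (F y - F z) \<le> C * (d y z)\<^sup>2"
        using b by (intro sums_le[OF _ sums_minus[OF s] t]) (simp add: abs_le_iff)
      ultimately show ?thesis by linarith
    qed
    have "\<exists>\<delta>>0. \<forall>y\<in>Z. 0 < d y z \<and> d y z < \<delta> \<longrightarrow> \<bar>F y - F z\<bar> < e * d y z" if "e > 0" for e
    proof (intro exI[of _ "e / (\<bar>C\<bar> + 1)"] conjI ballI impI)
      show "0 < e / (\<bar>C\<bar> + 1)" using that by simp
      fix y assume y: "y \<in> Z" and dy: "0 < d y z \<and> d y z < e / (\<bar>C\<bar> + 1)"
      then have "(\<bar>C\<bar> + 1) * d y z < e" by (simp add: field_simps)
      moreover have "C * d y z \<le> (\<bar>C\<bar> + 1) * d y z" using dy by (intro mult_right_mono) auto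
      ultimately have "C * d y z < e" by linarith
      then have "C * d y z * d y z < e * d y z" using dy by (intro mult_strict_right_mono) auto
      then show "\<bar>F y - F z\<bar> < e * d y z"
        using le[OF y] unfolding power2_eq_square mult.assoc[symmetric] by linarith
    qed
    then show "z \<in> argstat Z d F"
      unfolding iff using z by blast
  qed
  ultimately show ?thesis by blast
qed

section \<open>The horizon operators and kernels in coordinates\<close>

text \<open>
  The eigenvalues of the horizon operators for frequency \<open>w\<close> and horizon \<open>s\<close>, and the contribution
  of one mode to \<open>G_long\<close>.
\<close>

definition pcoef :: "real \<Rightarrow> real \<Rightarrow> real" where "pcoef w s = - 1 / (w * tan (w * s))"
definition qcoef :: "real \<Rightarrow> real \<Rightarrow> real" where "qcoef w s = 1 / (w * sin (w * s))"

definition mode_kernel :: "real \<Rightarrow> real \<Rightarrow> real \<Rightarrow> real \<Rightarrow> real" where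
  "mode_kernel w s a b = pcoef w s / 2 * (a\<^sup>2 + b\<^sup>2) + qcoef w s * (a * b)"

text \<open>
  The conventions \<open>tan x = sin x / cos x\<close> and \<open>x / 0 = 0\<close> give the right value also where the
  tangent has a pole.
\<close>

lemma pcoef_cos: "pcoef w s = - cos (w * s) * qcoef w s"
  by (simp add: pcoef_def qcoef_def tan_def)

locale kernel_space = energy_space +
  fixes \<mu> :: real
  assumes mu_pos: "0 < \<mu>"
begin

abbreviation freqm ("\<omega>") where "\<omega> \<equiv> freq lam \<mu>"

lemma freq_pos: "0 < \<omega> m"
  unfolding freq_def using lam_pos[of m] mu_pos
  by (intro real_sqrt_gt_zero divide_pos_pos add_pos_nonneg) auto

lemma freq_sq_inverse: "1 / (\<omega> m)\<^sup>2 = 1 / lam m + \<mu>\<^sup>2"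
proof -
  have "(\<omega> m)\<^sup>2 = lam m / (1 + \<mu>\<^sup>2 * lam m)"
    unfolding freq_def using lam_pos[of m] by (intro real_sqrt_pow2 divide_nonneg_nonneg) auto
  then show ?thesis using lam_pos[of m] by (simp add: field_simps)
qed

lemma freq_inverse_bounds: "\<mu>\<^sup>2 \<le> 1 / (\<omega> m)\<^sup>2" "1 / (\<omega> m)\<^sup>2 \<le> 1 / (\<omega> 0)\<^sup>2"
  unfolding freq_sq_inverse using lam_pos[of m] lam_0 lam_ge[of m] by (auto simp: frac_le)

lemma freq_le: "\<omega> m \<le> 1 / \<mu>"
proof (rule power2_le_imp_le)
  show "(\<omega> m)\<^sup>2 \<le> (1 / \<mu>)\<^sup>2"
    using freq_inverse_bounds(1)[of m] freq_pos[of m] mu_pos by (simp add: field_simps)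
qed (use mu_pos in simp)

lemma freq_ge: "\<omega> 0 \<le> \<omega> m"
proof -
  have "(\<omega> 0)\<^sup>2 \<le> (\<omega> m)\<^sup>2"
    using freq_inverse_bounds(2)[of m] freq_pos[of m] freq_pos[of 0] by (simp add: field_simps)
  then show ?thesis using freq_pos[of m] by (meson less_imp_le power2_le_imp_le)
qed

text \<open>
  At a nonresonant time the coefficients are bounded uniformly in the mode, which makes the
  diagonal operators everywhere defined.
\<close>

definition nonresonant :: "real \<Rightarrow> bool" where
  "nonresonant s \<longleftrightarrow> (\<exists>\<delta>>0. \<forall>m. \<delta> \<le> \<bar>sin (\<omega> m * s)\<bar>)"

lemma nonresonant_sin: "nonresonant s \<Longrightarrow> sin (\<omega> m * s) \<noteq> 0"
  by (auto simp: nonresonant_def) (metis abs_zero not_le)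

lemma nonresonant_inverse_sin:
  assumes "nonresonant s"
  obtains K where "K > 0" "\<And>m. \<bar>1 / sin (\<omega> m * s)\<bar> \<le> K"
proof -
  obtain \<delta> where "\<delta> > 0" "\<And>m. \<delta> \<le> \<bar>sin (\<omega> m * s)\<bar>" using assms by (auto simp: nonresonant_def)
  then show thesis by (intro that[of "1 / \<delta>"]) (auto simp: frac_le)
qed

lemma coef_bounds:
  assumes "nonresonant s"
  obtains K where "K > 0" "\<And>m. \<bar>pcoef (\<omega> m) s\<bar> \<le> K" "\<And>m. \<bar>qcoef (\<omega> m) s\<bar> \<le> K"
proof -
  obtain K where K: "K > 0" "\<And>m. \<bar>1 / sin (\<omega> m * s)\<bar> \<le> K"
    using nonresonant_inverse_sin[OF assms] by blast
  have q: "\<bar>qcoef (\<omega> m) s\<bar> \<le> (1 / \<omega> 0) * K" for m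
  proof -
    have "\<bar>qcoef (\<omega> m) s\<bar> = (1 / \<omega> m) * \<bar>1 / sin (\<omega> m * s)\<bar>"
      using freq_pos[of m] by (simp add: qcoef_def abs_mult)
    also have "\<dots> \<le> (1 / \<omega> 0) * K"
      using freq_pos[of m] freq_pos[of 0] freq_ge[of m] K by (intro mult_mono) (auto simp: frac_le)
    finally show ?thesis .
  qed
  have "\<bar>pcoef (\<omega> m) s\<bar> \<le> 1 * ((1 / \<omega> 0) * K)" for m
    unfolding pcoef_cos abs_mult using q by (intro mult_mono) auto
  with q K(1) freq_pos[of 0] show thesis by (intro that[of "(1 / \<omega> 0) * K"]) auto
qed

text \<open>
  The frequencies converge to \<open>1 / \<mu>\<close>, so the sines have the limit \<open>sin (s / \<mu>)\<close>; a sequence of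
  nonzero numbers with nonzero limit is bounded away from zero.
\<close>

lemma nonresonantI:
  assumes "filterlim lam at_top sequentially"
    and "\<And>m. sin (\<omega> m * s) \<noteq> 0" and "sin (s / \<mu>) \<noteq> 0"
  shows "nonresonant s"
proof -
  have "(\<lambda>m. inverse (lam m)) \<longlonglongrightarrow> 0" using assms(1) by (rule tendsto_inverse_0_at_top)
  then have "(\<lambda>m. sqrt (inverse (inverse (lam m) + \<mu>\<^sup>2))) \<longlonglongrightarrow> sqrt (inverse (0 + \<mu>\<^sup>2))"
    using mu_pos by (intro tendsto_intros) auto
  moreover have "sqrt (inverse (inverse (lam m) + \<mu>\<^sup>2)) = \<omega> m" for m
    using lam_pos[of m] by (simp add: freq_def field_simps)
  moreover have "sqrt (inverse (0 + \<mu>\<^sup>2)) = 1 / \<mu>"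
    using mu_pos by (simp add: real_sqrt_divide inverse_eq_divide)
  ultimately have "\<omega> \<longlonglongrightarrow> 1 / \<mu>" by simp
  then have "(\<lambda>m. sin (\<omega> m * s)) \<longlonglongrightarrow> sin (1 / \<mu> * s)" by (intro tendsto_intros)
  then have "(\<lambda>m. inverse (sin (\<omega> m * s))) \<longlonglongrightarrow> inverse (sin (s / \<mu>))"
    using assms(3) by (intro tendsto_inverse) auto
  then have "Bseq (\<lambda>m. inverse (sin (\<omega> m * s)))" by (intro convergent_imp_Bseq convergentI)
  then obtain K where "K > 0" "\<And>m. \<bar>inverse (sin (\<omega> m * s))\<bar> \<le> K" unfolding Bseq_def by auto
  then show ?thesis unfolding nonresonant_def using assms(2)
    by (intro exI[of _ "1 / K"]) (auto simp: field_simps)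
qed

lemma P_op_coord:
  assumes "nonresonant s" 
  shows "P_op X1 S \<phi> lam \<mu> s x \<in> X1"
    and "coord (P_op X1 S \<phi> lam \<mu> s x) m = pcoef (\<omega> m) s * coord x m"
proof -
  have "summable (\<lambda>m. (pcoef (\<omega> m) s * coord x m)\<^sup>2)"
    using assms by (rule coef_bounds) (rule summable_bounded_mult)
  from suminf1_coord[OF this]
  show "P_op X1 S \<phi> lam \<mu> s x \<in> X1"
    and "coord (P_op X1 S \<phi> lam \<mu> s x) m = pcoef (\<omega> m) s * coord x m"
    unfolding P_op_def inner1_phi1 pcoef_def by auto
qed

lemma Q_op_coord:
  assumes "nonresonant s" 
  shows "Q_op X1 S \<phi> lam \<mu> s x \<in> X1"
    and "coord (Q_op X1 S \<phi> lam \<mu> s x) m = qcoef (\<omega> m) s * coord x m"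
proof -
  have "summable (\<lambda>m. (qcoef (\<omega> m) s * coord x m)\<^sup>2)"
    using assms by (rule coef_bounds) (rule summable_bounded_mult)
  from suminf1_coord[OF this]
  show "Q_op X1 S \<phi> lam \<mu> s x \<in> X1"
    and "coord (Q_op X1 S \<phi> lam \<mu> s x) m = qcoef (\<omega> m) s * coord x m"
    unfolding Q_op_def inner1_phi1 qcoef_def by auto
qed

lemma G_long_sums:
  assumes "nonresonant s"
  shows "(\<lambda>m. mode_kernel (\<omega> m) s (coord x m) (coord y m)) sums G_long X1 S \<phi> lam \<mu> s x y"
proof -
  have "(\<lambda>m. coord x m * (pcoef (\<omega> m) s * coord x m) / 2 + coord x m * (qcoef (\<omega> m) s * coord y m)
      + coord y m * (pcoef (\<omega> m) s * coord y m) / 2) sums G_long X1 S \<phi> lam \<mu> s x y"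
    unfolding G_long_def P_op_coord(2)[OF assms, symmetric] Q_op_coord(2)[OF assms, symmetric]
    by (intro sums_add sums_divide inner1_sums)
  then show ?thesis by (simp add: mode_kernel_def power2_eq_square algebra_simps add_divide_distrib)
qed

end

section \<open>Square integrable functions on an interval and their primitives\<close>

definition sq_integrable :: "real \<Rightarrow> (real \<Rightarrow> 'b::{second_countable_topology,real_normed_vector}) \<Rightarrow> bool" where
  "sq_integrable T f \<longleftrightarrow> f \<in> borel_measurable lborel \<and> set_integrable lborel {0..T} (\<lambda>s. (norm (f s))\<^sup>2)"

lemma set_integral_mono_set:
  fixes f :: "real \<Rightarrow> real"
  assumes "set_integrable lborel B f" "A \<in> sets lborel" "A \<subseteq> B" "\<And>s. 0 \<le> f s"
  shows "(LINT s:A|lborel. f s) \<le> (LINT s:B|lborel. f s)"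
proof -
  have "set_integrable lborel A f" using assms(1-3) by (rule set_integrable_subset)
  with assms show ?thesis unfolding set_integrable_def set_lebesgue_integral_def
    by (intro integral_mono) (auto simp: indicator_def)
qed

lemma set_integral_nonneg:
  fixes f :: "real \<Rightarrow> real"
  shows "(\<And>s. 0 \<le> f s) \<Longrightarrow> 0 \<le> (LINT s:A|lborel. f s)"
  unfolding set_lebesgue_integral_def by (rule Bochner_Integration.integral_nonneg) simp

lemma set_integral_FTC:
  fixes F :: "real \<Rightarrow> real"
  assumes "a \<le> b" "\<And>s. (F has_real_derivative f s) (at s)" "continuous_on UNIV f"
  shows "(LINT s:{a..b}|lborel. f s) = F b - F a"
  unfolding set_lebesgue_integral_def using assms
  by (intro integral_FTC_Icc) (auto simp: has_real_derivative_iff_has_vector_derivative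
      intro: has_vector_derivative_at_within continuous_on_subset)

lemma set_integrable_const_Icc: "set_integrable lborel {a..b::real} (\<lambda>_. c::real)"
  by (intro borel_integrable_atLeastAtMost' continuous_intros)

lemma set_integrable_dominated:
  fixes f :: "real \<Rightarrow> 'b::{second_countable_topology,banach}"
  assumes "set_integrable lborel A g" "f \<in> borel_measurable lborel" "A \<in> sets lborel"
    and "\<And>s. s \<in> A \<Longrightarrow> norm (f s) \<le> (g s :: real)"
  shows "set_integrable lborel A f"
  unfolding set_integrable_def
proof (rule Bochner_Integration.integrable_bound)
  show "integrable lborel (\<lambda>s. indicator A s *\<^sub>R g s)" using assms(1) by (simp add: set_integrable_def)
  show "(\<lambda>s. indicator A s *\<^sub>R f s) \<in> borel_measurable lborel" using assms(2,3) by measurable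
  show "AE s in lborel. norm (indicator A s *\<^sub>R f s) \<le> norm (indicator A s *\<^sub>R g s)"
    using assms(4) by (intro always_eventually) (auto simp: indicator_def intro: order_trans[OF _ abs_ge_self])
qed

lemma sq_integrable_set_integrable:
  fixes f :: "real \<Rightarrow> 'b::{second_countable_topology,banach}"
  assumes "sq_integrable T f"
  shows "set_integrable lborel {0..T} f"
proof (rule set_integrable_dominated)
  show "set_integrable lborel {0..T} (\<lambda>s. 1 + (norm (f s))\<^sup>2)"
    using assms by (intro set_integral_add set_integrable_const_Icc) (auto simp: sq_integrable_def)
  show "f \<in> borel_measurable lborel" using assms by (simp add: sq_integrable_def)
  fix s
  have "2 * norm (f s) \<le> 1 + (norm (f s))\<^sup>2"
    using sum_squares_bound[of 1 "norm (f s)"] by simp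
  then show "norm (f s) \<le> 1 + (norm (f s))\<^sup>2" using norm_ge_zero[of "f s"] by linarith
qed simp

lemma sq_integrable_mult:
  fixes f g :: "real \<Rightarrow> real"
  assumes "sq_integrable T f" "sq_integrable T g"
  shows "set_integrable lborel {0..T} (\<lambda>s. f s * g s)"
proof (rule set_integrable_dominated)
  show "set_integrable lborel {0..T} (\<lambda>s. (norm (f s))\<^sup>2 + (norm (g s))\<^sup>2)"
    using assms by (intro set_integral_add) (auto simp: sq_integrable_def)
  show "(\<lambda>s. f s * g s) \<in> borel_measurable lborel"
    using assms by (intro borel_measurable_times) (auto simp: sq_integrable_def)
  fix s
  have "2 * (\<bar>f s\<bar> * \<bar>g s\<bar>) \<le> (norm (f s))\<^sup>2 + (norm (g s))\<^sup>2"
    using sum_squares_bound[of "\<bar>f s\<bar>" "\<bar>g s\<bar>"] by simp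
  moreover have "0 \<le> \<bar>f s\<bar> * \<bar>g s\<bar>" by simp
  ultimately show "norm (f s * g s) \<le> (norm (f s))\<^sup>2 + (norm (g s))\<^sup>2"
    unfolding real_norm_def abs_mult by linarith
qed simp

lemma sq_integrable_sq:
  fixes f :: "real \<Rightarrow> real"
  shows "sq_integrable T f \<Longrightarrow> set_integrable lborel {0..T} (\<lambda>s. (f s)\<^sup>2)"
  by (simp add: sq_integrable_def)

lemma sq_integrable_diff:
  fixes f g :: "real \<Rightarrow> real"
  assumes "sq_integrable T f" "sq_integrable T g"
  shows "sq_integrable T (\<lambda>s. f s - g s)"
  unfolding sq_integrable_def
proof
  show "(\<lambda>s. f s - g s) \<in> borel_measurable lborel"
    using assms by (intro borel_measurable_diff) (auto simp: sq_integrable_def)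
  have "set_integrable lborel {0..T} (\<lambda>s. (f s)\<^sup>2 - 2 * (f s * g s) + (g s)\<^sup>2)"
    using assms by (intro set_integral_add set_integral_diff set_integrable_mult_right
        sq_integrable_mult sq_integrable_sq)
  then show "set_integrable lborel {0..T} (\<lambda>s. (norm (f s - g s))\<^sup>2)"
    by (simp add: power2_diff algebra_simps)
qed

lemma sq_integrable_bounded:
  fixes f :: "real \<Rightarrow> 'b::{second_countable_topology,real_normed_vector}"
  assumes "f \<in> borel_measurable lborel" "\<And>s. s \<in> {0..T} \<Longrightarrow> norm (f s) \<le> K"
  shows "sq_integrable T f"
  unfolding sq_integrable_def
proof
  show "set_integrable lborel {0..T} (\<lambda>s. (norm (f s))\<^sup>2)"
  proof (rule set_integrable_dominated)
    show "set_integrable lborel {0..T} (\<lambda>s. K\<^sup>2)" by (rule set_integrable_const_Icc)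
    show "(\<lambda>s. (norm (f s))\<^sup>2) \<in> borel_measurable lborel" using assms(1) by measurable
    show "norm ((norm (f s))\<^sup>2) \<le> K\<^sup>2" if "s \<in> {0..T}" for s
      using assms(2)[OF that] by (simp add: power_mono)
  qed simp
qed (rule assms(1))

lemma sq_integrable_continuous:
  fixes f :: "real \<Rightarrow> 'b::{second_countable_topology,real_normed_vector}"
  assumes "continuous_on UNIV f"
  shows "sq_integrable T f"
proof -
  have "compact (f ` {0..T})"
    using assms by (intro compact_continuous_image) (auto intro: continuous_on_subset)
  then obtain K where "\<And>s. s \<in> {0..T} \<Longrightarrow> norm (f s) \<le> K"
    using compact_imp_bounded bounded_iff by (metis imageI)
  then show ?thesis
    using assms by (intro sq_integrable_bounded) (auto intro: borel_measurable_continuous_onI)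
qed

lemma measurable_primitive:
  fixes f :: "real \<Rightarrow> 'b::{second_countable_topology,banach}"
  assumes "f \<in> borel_measurable lborel"
  shows "(\<lambda>s. LINT \<sigma>:{0..s}|lborel. f \<sigma>) \<in> borel_measurable lborel"
proof -
  have [measurable]: "f \<in> borel_measurable borel" using assms by simp
  have "(\<lambda>s. LINT \<sigma>|lborel. (if 0 \<le> \<sigma> \<and> \<sigma> \<le> s then f \<sigma> else 0)) \<in> borel_measurable lborel"
    by measurable
  moreover have "(if 0 \<le> \<sigma> \<and> \<sigma> \<le> s then f \<sigma> else 0) = indicator {0..s} \<sigma> *\<^sub>R f \<sigma>" for s \<sigma>
    by (simp add: indicator_def)
  ultimately show ?thesis by (simp add: set_lebesgue_integral_def)
qed

lemma norm_primitive_le: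
  fixes f :: "real \<Rightarrow> 'b::{second_countable_topology,banach}"
  assumes "set_integrable lborel {0..T} f" "s \<le> T"
  shows "norm (LINT \<sigma>:{0..s}|lborel. f \<sigma>) \<le> (LINT \<sigma>:{0..T}|lborel. norm (f \<sigma>))"
proof -
  have s: "set_integrable lborel {0..s} f" using assms by (auto intro: set_integrable_subset)
  have "norm (LINT \<sigma>:{0..s}|lborel. f \<sigma>) \<le> (LINT \<sigma>:{0..s}|lborel. norm (f \<sigma>))"
    using s by (rule set_integral_norm_bound)
  also have "\<dots> \<le> (LINT \<sigma>:{0..T}|lborel. norm (f \<sigma>))"
    using assms by (intro set_integral_mono_set set_integrable_norm) auto
  finally show ?thesis .
qed

lemma sq_integrable_primitive:
  fixes f :: "real \<Rightarrow> 'b::{second_countable_topology,banach}"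
  assumes "sq_integrable T f"
  shows "sq_integrable T (\<lambda>s. c + (LINT \<sigma>:{0..s}|lborel. f \<sigma>))"
proof (rule sq_integrable_bounded)
  show "(\<lambda>s. c + (LINT \<sigma>:{0..s}|lborel. f \<sigma>)) \<in> borel_measurable lborel"
    using assms by (intro borel_measurable_add measurable_primitive) (auto simp: sq_integrable_def)
  fix s assume "s \<in> {0..T}"
  then show "norm (c + (LINT \<sigma>:{0..s}|lborel. f \<sigma>)) \<le> norm c + (LINT \<sigma>:{0..T}|lborel. norm (f \<sigma>))"
    using norm_primitive_le[OF sq_integrable_set_integrable[OF assms], of s]
    by (intro order_trans[OF norm_triangle_ineq]) auto
qed

text \<open>
  Cauchy-Schwarz, obtained from the nonnegativity of the variance of \<open>g\<close> on \<open>{0..s}\<close>.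
\<close>

lemma primitive_sq_le:
  fixes g :: "real \<Rightarrow> real"
  assumes g: "sq_integrable T g" and s: "s \<in> {0..T}"
  shows "(LINT \<sigma>:{0..s}|lborel. g \<sigma>)\<^sup>2 \<le> s * (LINT \<sigma>:{0..T}|lborel. (g \<sigma>)\<^sup>2)"
proof (cases "s = 0")
  case True
  have "AE \<sigma> in lborel. indicator {0..0} \<sigma> *\<^sub>R g \<sigma> = 0"
    using AE_lborel_singleton[of "0::real"] by eventually_elim (simp add: indicator_def)
  then have "(LINT \<sigma>:{0..0}|lborel. g \<sigma>) = 0"
    unfolding set_lebesgue_integral_def by (rule integral_eq_zero_AE)
  with True show ?thesis by simp
next
  case False
  with s have "s > 0" by simp
  let ?h = "LINT \<sigma>:{0..s}|lborel. g \<sigma>"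
  have sub: "{0..s} \<subseteq> {0..T}" using s by auto
  have i1: "set_integrable lborel {0..s} g" and i2: "set_integrable lborel {0..s} (\<lambda>\<sigma>. (g \<sigma>)\<^sup>2)"
    using set_integrable_subset[OF sq_integrable_set_integrable[OF g] _ sub]
      set_integrable_subset[OF sq_integrable_sq[OF g] _ sub] by auto
  have "0 \<le> (LINT \<sigma>:{0..s}|lborel. (g \<sigma> - ?h / s)\<^sup>2)"
    by (rule set_integral_nonneg) auto
  also have "\<dots> = (LINT \<sigma>:{0..s}|lborel. (g \<sigma>)\<^sup>2 - (2 * ?h / s) * g \<sigma> + (?h / s)\<^sup>2)"
    by (simp add: power2_diff algebra_simps)
  also have "\<dots> = (LINT \<sigma>:{0..s}|lborel. (g \<sigma>)\<^sup>2) - (2 * ?h / s) * ?h + (LINT \<sigma>:{0..s}|lborel. (?h / s)\<^sup>2)"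
    using i1 i2 by (simp only: set_integral_add set_integral_diff set_integrable_mult_right
        set_integral_mult_right set_integrable_const_Icc)
  also have "(LINT \<sigma>:{0..s}|lborel. (?h / s)\<^sup>2) = s * (?h / s)\<^sup>2"
    using \<open>s > 0\<close> by (subst set_integral_const) auto
  also have "(LINT \<sigma>:{0..s}|lborel. (g \<sigma>)\<^sup>2) - (2 * ?h / s) * ?h + s * (?h / s)\<^sup>2
      = (LINT \<sigma>:{0..s}|lborel. (g \<sigma>)\<^sup>2) - ?h\<^sup>2 / s"
    using \<open>s > 0\<close> by (simp add: power2_eq_square field_simps)
  finally have "?h\<^sup>2 \<le> s * (LINT \<sigma>:{0..s}|lborel. (g \<sigma>)\<^sup>2)" using \<open>s > 0\<close> by (simp add: field_simps)
  also have "\<dots> \<le> s * (LINT \<sigma>:{0..T}|lborel. (g \<sigma>)\<^sup>2)"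
    using \<open>s > 0\<close> sub sq_integrable_sq[OF g]
    by (intro mult_left_mono set_integral_mono_set) auto
  finally show ?thesis .
qed

lemma poincare:
  fixes g :: "real \<Rightarrow> real"
  assumes g: "sq_integrable T g" and "0 \<le> T"
  shows "(LINT s:{0..T}|lborel. (LINT \<sigma>:{0..s}|lborel. g \<sigma>)\<^sup>2)
    \<le> T\<^sup>2 / 2 * (LINT \<sigma>:{0..T}|lborel. (g \<sigma>)\<^sup>2)"
proof -
  let ?E = "LINT \<sigma>:{0..T}|lborel. (g \<sigma>)\<^sup>2"
  have "(LINT s:{0..T}|lborel. (LINT \<sigma>:{0..s}|lborel. g \<sigma>)\<^sup>2) \<le> (LINT s:{0..T}|lborel. s * ?E)"
  proof (rule set_integral_mono)
    show "set_integrable lborel {0..T} (\<lambda>s. (LINT \<sigma>:{0..s}|lborel. g \<sigma>)\<^sup>2)"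
      using sq_integrable_sq[OF sq_integrable_primitive[OF g, of 0]] by simp
    show "set_integrable lborel {0..T} (\<lambda>s. s * ?E)"
      by (intro borel_integrable_atLeastAtMost' continuous_intros)
  qed (rule primitive_sq_le[OF g])
  also have "(LINT s:{0..T}|lborel. s * ?E) = T\<^sup>2 / 2 * ?E"
  proof -
    have "(LINT s:{0..T}|lborel. s) = T\<^sup>2 / 2 - 0\<^sup>2 / 2"
      using \<open>0 \<le> T\<close> by (intro set_integral_FTC) (auto intro!: derivative_eq_intros continuous_intros)
    then show ?thesis by simp
  qed
  finally show ?thesis .
qed

lemma integrable_lborel_pair_mult:
  fixes f g :: "real \<Rightarrow> real"
  assumes "integrable lborel f" "integrable lborel g"
  shows "integrable (lborel \<Otimes>\<^sub>M lborel) (\<lambda>(s, \<sigma>). f s * g \<sigma>)"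
proof (rule lborel_pair.Fubini_integrable)
  show "(\<lambda>(s, \<sigma>). f s * g \<sigma>) \<in> borel_measurable (lborel \<Otimes>\<^sub>M lborel)"
    using assms by measurable
  show "integrable lborel (\<lambda>x. LINT y|lborel. norm (case (x, y) of (s, \<sigma>) \<Rightarrow> f s * g \<sigma>))"
    using assms by (simp add: abs_mult)
  show "AE x in lborel. integrable lborel (\<lambda>y. case (x, y) of (s, \<sigma>) \<Rightarrow> f s * g \<sigma>)"
    using assms by simp
qed

text \<open>
  A primitive of a square integrable function is differentiable only almost everywhere; instead of
  the product rule, the order of integration over the triangle \<open>0 \<le> \<sigma> \<le> s \<le> T\<close> is exchanged.
\<close>

lemma integral_by_parts_primitive:
  fixes g p p' :: "real \<Rightarrow> real"
  assumes g: "sq_integrable T g" and "0 \<le> T"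
    and p: "\<And>s. (p has_real_derivative p' s) (at s)" and p': "continuous_on UNIV p'"
  shows "(LINT s:{0..T}|lborel. p' s * (LINT \<sigma>:{0..s}|lborel. g \<sigma>) + p s * g s)
    = p T * (LINT \<sigma>:{0..T}|lborel. g \<sigma>)"
proof -
  let ?h = "\<lambda>s. LINT \<sigma>:{0..s}|lborel. g \<sigma>"
  have [measurable]: "g \<in> borel_measurable borel" using g by (simp add: sq_integrable_def)
  have [measurable]: "p' \<in> borel_measurable borel" using p' by (rule borel_measurable_continuous_onI)
  have cp: "continuous_on UNIV p" using p by (intro DERIV_continuous_on) auto
  have ig: "set_integrable lborel {0..T} g" by (rule sq_integrable_set_integrable[OF g])
  have ip: "set_integrable lborel {0..T} p'"
    by (intro borel_integrable_atLeastAtMost' continuous_on_subset[OF p']) auto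
  define f where "f = (\<lambda>s \<sigma>. (indicator {0..T} s * p' s) * (indicator {0..T} \<sigma> * g \<sigma>) * (if \<sigma> \<le> s then 1 else 0 :: real))"
  have int: "integrable (lborel \<Otimes>\<^sub>M lborel) (\<lambda>(s, \<sigma>). f s \<sigma>)"
  proof (rule Bochner_Integration.integrable_bound)
    show "integrable (lborel \<Otimes>\<^sub>M lborel) (\<lambda>(s, \<sigma>). (indicator {0..T} s * p' s) * (indicator {0..T} \<sigma> * g \<sigma>))"
      by (rule integrable_lborel_pair_mult) (use ig ip in \<open>simp_all add: set_integrable_def\<close>)
    show "(\<lambda>(s, \<sigma>). f s \<sigma>) \<in> borel_measurable (lborel \<Otimes>\<^sub>M lborel)"
      unfolding f_def by measurable
    show "AE x in lborel \<Otimes>\<^sub>M lborel. norm (case x of (s, \<sigma>) \<Rightarrow> f s \<sigma>)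
       \<le> norm (case x of (s, \<sigma>) \<Rightarrow> (indicator {0..T} s * p' s) * (indicator {0..T} \<sigma> * g \<sigma>))"
      by (intro AE_I2) (auto simp: f_def)
  qed
  have f1: "(LINT \<sigma>|lborel. f s \<sigma>) = indicator {0..T} s *\<^sub>R (p' s * ?h s)" for s
  proof -
    have "f s = (\<lambda>\<sigma>. (indicator {0..T} s * p' s) * (indicator {0..s} \<sigma> *\<^sub>R g \<sigma>))"
      by (auto simp: f_def indicator_def)
    then show ?thesis by (simp add: set_lebesgue_integral_def)
  qed
  have f2: "(LINT s|lborel. f s \<sigma>) = indicator {0..T} \<sigma> *\<^sub>R (g \<sigma> * (p T - p \<sigma>))" for \<sigma>
  proof (cases "\<sigma> \<in> {0..T}")
    case True
    have "(\<lambda>s. f s \<sigma>) = (\<lambda>s. g \<sigma> * (indicator {\<sigma>..T} s *\<^sub>R p' s))"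
      using True by (auto simp: f_def indicator_def)
    moreover have "(LINT s|lborel. indicator {\<sigma>..T} s *\<^sub>R p' s) = p T - p \<sigma>"
      using set_integral_FTC[OF _ p p', of \<sigma> T] True by (simp add: set_lebesgue_integral_def)
    ultimately show ?thesis using True by simp
  qed (simp add: f_def)
  have "(LINT s:{0..T}|lborel. p' s * ?h s) = (LINT s|lborel. LINT \<sigma>|lborel. f s \<sigma>)"
    unfolding f1 set_lebesgue_integral_def ..
  also have "\<dots> = (LINT \<sigma>|lborel. LINT s|lborel. f s \<sigma>)"
    by (rule lborel_pair.Fubini_integral[OF int, symmetric])
  also have "\<dots> = (LINT \<sigma>:{0..T}|lborel. p T * g \<sigma> - p \<sigma> * g \<sigma>)"
    unfolding f2 set_lebesgue_integral_def by (simp add: algebra_simps)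
  also have "\<dots> = p T * ?h T - (LINT \<sigma>:{0..T}|lborel. p \<sigma> * g \<sigma>)"
    using ig sq_integrable_mult[OF sq_integrable_continuous[OF cp] g] by (subst set_integral_diff) auto
  finally have "(LINT s:{0..T}|lborel. p' s * ?h s) + (LINT \<sigma>:{0..T}|lborel. p \<sigma> * g \<sigma>) = p T * ?h T"
    by simp
  moreover have "(LINT s:{0..T}|lborel. p' s * ?h s + p s * g s)
    = (LINT s:{0..T}|lborel. p' s * ?h s) + (LINT \<sigma>:{0..T}|lborel. p \<sigma> * g \<sigma>)"
    using sq_integrable_mult[OF sq_integrable_continuous[OF p'] sq_integrable_primitive[OF g, of 0]]
      sq_integrable_mult[OF sq_integrable_continuous[OF cp] g]
    by (intro set_integral_add) auto
  ultimately show ?thesis by simp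
qed

section \<open>The scalar harmonic oscillator on a short horizon\<close>

text \<open>The classical path from \<open>a\<close> to \<open>b\<close> in time \<open>T\<close> and its velocity.\<close>

definition osc_path :: "real \<Rightarrow> real \<Rightarrow> real \<Rightarrow> real \<Rightarrow> real \<Rightarrow> real" where
  "osc_path w T a b s = (a * sin (w * (T - s)) + b * sin (w * s)) / sin (w * T)"

definition osc_vel :: "real \<Rightarrow> real \<Rightarrow> real \<Rightarrow> real \<Rightarrow> real \<Rightarrow> real" where
  "osc_vel w T a b s = w * (b * cos (w * s) - a * cos (w * (T - s))) / sin (w * T)"

lemma osc_path_deriv: "(osc_path w T a b has_real_derivative osc_vel w T a b s) (at s)"
proof -
  have "((\<lambda>s. a * sin (w * (T - s)) + b * sin (w * s)) has_real_derivative
      w * (b * cos (w * s) - a * cos (w * (T - s)))) (at s)"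
    by (auto intro!: derivative_eq_intros simp: algebra_simps)
  from DERIV_cdivide[OF this, of "sin (w * T)"] show ?thesis
    by (simp add: osc_path_def[abs_def] osc_vel_def)
qed

lemma osc_vel_deriv: "(osc_vel w T a b has_real_derivative - w\<^sup>2 * osc_path w T a b s) (at s)"
proof -
  have "((\<lambda>s. w * (b * cos (w * s) - a * cos (w * (T - s)))) has_real_derivative
      - w\<^sup>2 * (a * sin (w * (T - s)) + b * sin (w * s))) (at s)"
    by (auto intro!: derivative_eq_intros simp: algebra_simps power2_eq_square)
  from DERIV_cdivide[OF this, of "sin (w * T)"] show ?thesis
    by (simp add: osc_path_def osc_vel_def[abs_def])
qed

lemma continuous_osc_path: "continuous_on UNIV (osc_path w T a b)"
  by (intro DERIV_continuous_on[OF has_field_derivative_at_within[OF osc_path_deriv]])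

lemma continuous_osc_vel: "continuous_on UNIV (osc_vel w T a b)"
  by (intro DERIV_continuous_on[OF has_field_derivative_at_within[OF osc_vel_deriv]])

lemma osc_path_endpoints:
  assumes "sin (w * T) \<noteq> 0"
  shows "osc_path w T a b 0 = a" "osc_path w T a b T = b"
  using assms by (auto simp: osc_path_def)

lemma osc_vel_primitive:
  assumes "0 \<le> s"
  shows "(LINT \<sigma>:{0..s}|lborel. osc_vel w T a b \<sigma>) = osc_path w T a b s - osc_path w T a b 0"
  using assms by (intro set_integral_FTC osc_path_deriv continuous_osc_vel)

text \<open>
  The action of a classical path is half the difference of \<open>- x * v / w\<^sup>2\<close> at its two ends, by the
  equation of motion; this evaluates the difference.
\<close>

lemma osc_boundary_value:
  assumes "w \<noteq> 0" "sin (w * T) \<noteq> 0"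
  shows "- (b * osc_vel w T a b T - a * osc_vel w T a b 0) / (2 * w\<^sup>2) = mode_kernel w T a b"
proof -
  have vel: "osc_vel w T a b T = w * (b * cos (w * T) - a) / sin (w * T)"
    "osc_vel w T a b 0 = w * (b - a * cos (w * T)) / sin (w * T)"
    by (simp_all add: osc_vel_def)
  show ?thesis unfolding vel using assms
    by (simp add: mode_kernel_def pcoef_cos qcoef_def field_simps power2_eq_square)
qed

definition osc_lagrangian :: "real \<Rightarrow> real \<Rightarrow> real \<Rightarrow> real" where
  "osc_lagrangian w x v = x\<^sup>2 / 2 - v\<^sup>2 / (2 * w\<^sup>2)"

lemma osc_path_action:
  assumes "w \<noteq> 0" "0 \<le> T" "sin (w * T) \<noteq> 0"
  shows "(LINT s:{0..T}|lborel. osc_lagrangian w (osc_path w T a b s) (osc_vel w T a b s)) = mode_kernel w T a b"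
proof -
  let ?F = "\<lambda>s. - (osc_path w T a b s * osc_vel w T a b s) / (2 * w\<^sup>2)"
  have "(?F has_real_derivative osc_lagrangian w (osc_path w T a b s) (osc_vel w T a b s)) (at s)" for s
    unfolding osc_lagrangian_def using assms(1)
    by (auto intro!: derivative_eq_intros osc_path_deriv osc_vel_deriv simp: field_simps power2_eq_square)
  moreover have "continuous_on UNIV (\<lambda>s. osc_lagrangian w (osc_path w T a b s) (osc_vel w T a b s))"
    unfolding osc_lagrangian_def using assms(1)
    by (intro continuous_intros continuous_osc_path continuous_osc_vel) auto
  ultimately have "(LINT s:{0..T}|lborel. osc_lagrangian w (osc_path w T a b s) (osc_vel w T a b s)) = ?F T - ?F 0"
    using assms(2) by (intro set_integral_FTC)
  also have "\<dots> = mode_kernel w T a b"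
    using osc_boundary_value[OF assms(1,3), of b a] assms
    by (simp add: osc_path_endpoints diff_divide_distrib)
  finally show ?thesis .
qed

text \<open>
  Write a path as the classical one plus a variation \<open>h\<close> that vanishes at both ends.  The mixed
  term of the action integrates to a boundary term, which is zero, and Poincare's inequality makes
  the action of \<open>h\<close> nonpositive as long as \<open>T\<^sup>2 / 2 \<le> 1 / w\<^sup>2\<close>.
\<close>

lemma osc_action_le:
  assumes w: "0 < w" and T: "0 \<le> T" and short: "w\<^sup>2 * T\<^sup>2 \<le> 2" and sin: "sin (w * T) \<noteq> 0"
    and v: "sq_integrable T v"
    and b: "a + (LINT \<sigma>:{0..T}|lborel. v \<sigma>) = b"
  shows "(LINT s:{0..T}|lborel. osc_lagrangian w (a + (LINT \<sigma>:{0..s}|lborel. v \<sigma>)) (v s)) \<le> mode_kernel w T a b"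
proof -
  let ?U = "osc_path w T a b" and ?p = "osc_vel w T a b"
  define g where "g = (\<lambda>s. v s - ?p s)"
  define h where "h = (\<lambda>s. LINT \<sigma>:{0..s}|lborel. g \<sigma>)"
  have p: "sq_integrable T ?p" and U: "sq_integrable T ?U"
    by (auto intro: sq_integrable_continuous continuous_osc_path continuous_osc_vel)
  have g: "sq_integrable T g" unfolding g_def by (rule sq_integrable_diff[OF v p])
  have h: "sq_integrable T h" using sq_integrable_primitive[OF g, of 0] by (simp add: h_def)
  have u: "a + (LINT \<sigma>:{0..s}|lborel. v \<sigma>) = ?U s + h s" if "s \<in> {0..T}" for s
  proof -
    have sub: "{0..s} \<subseteq> {0..T}" using that by auto
    have "h s = (LINT \<sigma>:{0..s}|lborel. v \<sigma>) - (LINT \<sigma>:{0..s}|lborel. ?p \<sigma>)"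
      unfolding h_def g_def
      using set_integrable_subset[OF sq_integrable_set_integrable[OF v] _ sub]
        set_integrable_subset[OF sq_integrable_set_integrable[OF p] _ sub]
      by (intro set_integral_diff) auto
    then show ?thesis
      using that osc_vel_primitive[of s w T a b] osc_path_endpoints[OF sin, of a b] by simp
  qed
  have hT: "h T = 0" using u[of T] T b osc_path_endpoints[OF sin, of a b] by simp
  let ?A = "\<lambda>s. osc_lagrangian w (?U s) (?p s)"
  let ?B = "\<lambda>s. - (1 / w\<^sup>2) * (- w\<^sup>2 * ?U s * h s + ?p s * g s)"
  let ?C = "\<lambda>s. (h s)\<^sup>2 / 2 - (1 / (2 * w\<^sup>2)) * (g s)\<^sup>2"
  have iA: "set_integrable lborel {0..T} ?A"
    unfolding osc_lagrangian_def
    by (intro set_integral_diff set_integrable_divide sq_integrable_sq U p)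
  have iB: "set_integrable lborel {0..T} ?B"
  proof -
    have "set_integrable lborel {0..T} (\<lambda>s. - (1 / w\<^sup>2) * (- w\<^sup>2 * (?U s * h s) + ?p s * g s))"
      by (intro set_integrable_mult_right set_integral_add sq_integrable_mult U h p g)
    then show ?thesis by (simp add: mult.assoc)
  qed
  have iC: "set_integrable lborel {0..T} ?C"
    by (intro set_integral_diff set_integrable_divide set_integrable_mult_right sq_integrable_sq h g)
  have "(LINT s:{0..T}|lborel. osc_lagrangian w (a + (LINT \<sigma>:{0..s}|lborel. v \<sigma>)) (v s))
      = (LINT s:{0..T}|lborel. ?A s + ?B s + ?C s)"
  proof (intro set_lebesgue_integral_cong ballI allI impI)
    fix s assume "s \<in> {0..T}"
    have "v s = ?p s + g s" by (simp add: g_def)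
    then show "osc_lagrangian w (a + (LINT \<sigma>:{0..s}|lborel. v \<sigma>)) (v s) = ?A s + ?B s + ?C s"
      unfolding u[OF \<open>s \<in> {0..T}\<close>] osc_lagrangian_def using w
      by (simp add: field_simps power2_eq_square)
  qed simp
  also have "\<dots> = (LINT s:{0..T}|lborel. ?A s) + (LINT s:{0..T}|lborel. ?B s) + (LINT s:{0..T}|lborel. ?C s)"
    by (simp only: set_integral_add(2)[OF set_integral_add(1)[OF iA iB] iC] set_integral_add(2)[OF iA iB])
  also have "(LINT s:{0..T}|lborel. ?A s) = mode_kernel w T a b"
    using w T sin by (intro osc_path_action) auto
  also have "(LINT s:{0..T}|lborel. ?B s) = 0"
  proof -
    have "(LINT s:{0..T}|lborel. - w\<^sup>2 * ?U s * h s + ?p s * g s) = ?p T * h T"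
      unfolding h_def using continuous_osc_path
      by (intro integral_by_parts_primitive g T osc_vel_deriv continuous_intros)
    then show ?thesis unfolding set_integral_mult_right hT by simp
  qed
  also have "(LINT s:{0..T}|lborel. ?C s) \<le> 0"
  proof -
    let ?E = "LINT s:{0..T}|lborel. (g s)\<^sup>2"
    have "(LINT s:{0..T}|lborel. ?C s) = (LINT s:{0..T}|lborel. (h s)\<^sup>2) / 2 - (1 / (2 * w\<^sup>2)) * ?E"
      using sq_integrable_sq[OF h] sq_integrable_sq[OF g] by (subst set_integral_diff(2)) auto
    also have "\<dots> \<le> (T\<^sup>2 / 2 * ?E) / 2 - (1 / (2 * w\<^sup>2)) * ?E"
      using poincare[OF g T] by (simp add: h_def)
    also have "\<dots> = ((w\<^sup>2 * T\<^sup>2 - 2) / (4 * w\<^sup>2)) * ?E" using w by (simp add: field_simps)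
    also have "\<dots> \<le> 0"
      using short by (intro mult_nonpos_nonneg divide_nonpos_nonneg set_integral_nonneg) auto
    finally show ?thesis .
  qed
  finally show ?thesis by simp
qed

section \<open>The short horizon kernel\<close>

lemma inner_set_integral:
  fixes f :: "real \<Rightarrow> 'b::{real_inner,banach,second_countable_topology}"
  assumes "set_integrable M A f"
  shows "(LINT s:A|M. f s) \<bullet> c = (LINT s:A|M. f s \<bullet> c)"
  using integral_bounded_linear[OF bounded_linear_inner_left assms[unfolded set_integrable_def], of c]
  by (simp add: set_lebesgue_integral_def)

context energy_space
begin

definition Sinv :: "'a \<Rightarrow> 'a" where "Sinv = inv_into X1 S"

lemma Sinv_mem: "Sinv u \<in> X1" and S_Sinv: "S (Sinv u) = u"
  using S_bij by (auto simp: Sinv_def bij_betw_def inv_into_into f_inv_into_f)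

lemma Sinv_S: "x \<in> X1 \<Longrightarrow> Sinv (S x) = x"
  using S_bij by (simp add: Sinv_def bij_betw_def)

lemma Sinv_coord: "Sinv u \<bullet> \<phi> m = (u \<bullet> \<phi> m) / sqrt (lam m)"
  using S_coord[OF Sinv_mem, of u m] lam_pos[of m] by (simp add: S_Sinv field_simps)

lemma bounded_linear_Sinv: "bounded_linear Sinv"
proof (rule bounded_linear_intro)
  show "Sinv (u + v) = Sinv u + Sinv v" for u v
    by (rule basis_coord_eqI) (simp add: Sinv_coord inner_add_left add_divide_distrib)
  show "Sinv (c *\<^sub>R u) = c *\<^sub>R Sinv u" for c u
    by (rule basis_coord_eqI) (simp add: Sinv_coord)
  show "norm (Sinv u) \<le> norm u * (1 / sqrt (lam 0))" for u
  proof -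
    have t: "(Sinv u \<bullet> \<phi> m)\<^sup>2 \<le> (u \<bullet> \<phi> m)\<^sup>2 * (1 / lam 0)" for m
    proof -
      have "(Sinv u \<bullet> \<phi> m)\<^sup>2 = (u \<bullet> \<phi> m)\<^sup>2 * (1 / lam m)"
        using lam_pos[of m] by (simp add: Sinv_coord power_divide)
      also have "\<dots> \<le> (u \<bullet> \<phi> m)\<^sup>2 * (1 / lam 0)"
        using lam_ge[of m] lam_0 by (intro mult_left_mono) (auto simp: frac_le)
      finally show ?thesis .
    qed
    have "(norm (Sinv u))\<^sup>2 \<le> (norm u)\<^sup>2 * (1 / lam 0)"
      by (rule sums_le[OF t parseval_norm sums_mult2[OF parseval_norm]])
    also have "\<dots> = (norm u * (1 / sqrt (lam 0)))\<^sup>2"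
      using lam_0 by (simp add: power_mult_distrib power_divide)
    finally show ?thesis by (rule power2_le_imp_le) (use lam_0 in simp)
  qed
qed

text \<open>
  An admissible velocity \<open>w\<close> is handled through \<open>S (w s)\<close>, cut off outside the horizon.  As
  \<open>w = Sinv (S w)\<close> with \<open>Sinv\<close> bounded, the operator \<open>S\<close> can be moved inside the integral defining
  the trajectory.
\<close>

definition velocity :: "real \<Rightarrow> (real \<Rightarrow> 'a) \<Rightarrow> real \<Rightarrow> 'a" where
  "velocity T w s = indicator {0..T} s *\<^sub>R S (w s)"

lemma norm1_eq: "norm1 S x = norm (S x)"
  by (simp add: norm1_def inner1_def norm_eq_sqrt_inner)

lemma sq_integrable_velocity:
  assumes "w \<in> L2_X1 X1 S T"
  shows "sq_integrable T (velocity T w)"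
  unfolding sq_integrable_def
proof
  show "velocity T w \<in> borel_measurable lborel"
    using assms unfolding L2_X1_def set_borel_measurable_def velocity_def[abs_def] by simp
  have "set_integrable lborel {0..T} (\<lambda>s. (norm1 S (w s))\<^sup>2)" using assms by (simp add: L2_X1_def)
  then show "set_integrable lborel {0..T} (\<lambda>s. (norm (velocity T w s))\<^sup>2)"
    by (rule set_integrable_cong[THEN iffD1, rotated -1]) (auto simp: velocity_def norm1_eq)
qed

lemma trajectory_mem:
  assumes "\<xi> \<in> X1" and w: "w \<in> L2_X1 X1 S T" and s: "s \<in> {0..T}"
  shows "trajectory \<xi> w s \<in> X1"
    and "S (trajectory \<xi> w s) = S \<xi> + (LINT \<sigma>:{0..s}|lborel. velocity T w \<sigma>)"
proof -
  let ?I = "LINT \<sigma>:{0..s}|lborel. velocity T w \<sigma>"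
  have "set_integrable lborel {0..s} (velocity T w)"
    using sq_integrable_set_integrable[OF sq_integrable_velocity[OF w]] s
    by (auto intro: set_integrable_subset)
  then have "(LINT \<sigma>|lborel. Sinv (indicator {0..s} \<sigma> *\<^sub>R velocity T w \<sigma>)) = Sinv ?I"
    unfolding set_integrable_def set_lebesgue_integral_def
    by (rule integral_bounded_linear[OF bounded_linear_Sinv])
  moreover have "Sinv (indicator {0..s} \<sigma> *\<^sub>R velocity T w \<sigma>) = indicator {0..s} \<sigma> *\<^sub>R w \<sigma>" for \<sigma>
    using s w linear_0[OF bounded_linear.linear[OF bounded_linear_Sinv]]
    by (auto simp: indicator_def velocity_def L2_X1_def Sinv_S)
  ultimately have "trajectory \<xi> w s = \<xi> + Sinv ?I"
    by (simp add: trajectory_def set_lebesgue_integral_def)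
  then show "trajectory \<xi> w s \<in> X1" and "S (trajectory \<xi> w s) = S \<xi> + ?I"
    using assms(1) X1_subspace by (auto simp: Sinv_mem S_Sinv S_add subspace_add)
qed

end

context kernel_space
begin

lemma lagrangian_sums:
  "(\<lambda>m. osc_lagrangian (\<omega> m) (u \<bullet> \<phi> m) (v \<bullet> \<phi> m)) sums
    ((norm u)\<^sup>2 / 2 - ((norm (Sinv v))\<^sup>2 / 2 + \<mu>\<^sup>2 / 2 * (norm v)\<^sup>2))"
proof -
  have "osc_lagrangian (\<omega> m) (u \<bullet> \<phi> m) (v \<bullet> \<phi> m)
      = (u \<bullet> \<phi> m)\<^sup>2 / 2 - ((Sinv v \<bullet> \<phi> m)\<^sup>2 / 2 + \<mu>\<^sup>2 / 2 * (v \<bullet> \<phi> m)\<^sup>2)" for m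
  proof -
    have "(v \<bullet> \<phi> m)\<^sup>2 / (2 * (\<omega> m)\<^sup>2) = (v \<bullet> \<phi> m)\<^sup>2 / 2 * (1 / (\<omega> m)\<^sup>2)" by simp
    also have "\<dots> = (Sinv v \<bullet> \<phi> m)\<^sup>2 / 2 + \<mu>\<^sup>2 / 2 * (v \<bullet> \<phi> m)\<^sup>2"
      unfolding freq_sq_inverse Sinv_coord using lam_pos[of m] by (simp add: power_divide algebra_simps)
    finally show ?thesis by (simp add: osc_lagrangian_def)
  qed
  then show ?thesis by (simp only:) (intro sums_diff sums_add sums_divide sums_mult parseval_norm)
qed

lemma lagrangian_sum_le:
  assumes "finite A"
  shows "\<bar>\<Sum>m\<in>A. osc_lagrangian (\<omega> m) (u \<bullet> \<phi> m) (v \<bullet> \<phi> m)\<bar>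
    \<le> (norm u)\<^sup>2 / 2 + 1 / (\<omega> 0)\<^sup>2 * ((norm v)\<^sup>2 / 2)"
proof -
  have "\<bar>\<Sum>m\<in>A. osc_lagrangian (\<omega> m) (u \<bullet> \<phi> m) (v \<bullet> \<phi> m)\<bar>
      \<le> (\<Sum>m\<in>A. (u \<bullet> \<phi> m)\<^sup>2 / 2 + 1 / (\<omega> 0)\<^sup>2 * ((v \<bullet> \<phi> m)\<^sup>2 / 2))"
  proof (rule order_trans[OF sum_abs], rule sum_mono)
    fix m
    have "1 / (\<omega> m)\<^sup>2 * ((v \<bullet> \<phi> m)\<^sup>2 / 2) \<le> 1 / (\<omega> 0)\<^sup>2 * ((v \<bullet> \<phi> m)\<^sup>2 / 2)"
      by (intro mult_right_mono freq_inverse_bounds) auto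
    moreover have "0 \<le> 1 / (\<omega> m)\<^sup>2 * ((v \<bullet> \<phi> m)\<^sup>2 / 2)" by simp
    moreover have "osc_lagrangian (\<omega> m) (u \<bullet> \<phi> m) (v \<bullet> \<phi> m)
        = (u \<bullet> \<phi> m)\<^sup>2 / 2 - 1 / (\<omega> m)\<^sup>2 * ((v \<bullet> \<phi> m)\<^sup>2 / 2)"
      by (simp add: osc_lagrangian_def)
    moreover have "0 \<le> (u \<bullet> \<phi> m)\<^sup>2 / 2" by simp
    ultimately show "\<bar>osc_lagrangian (\<omega> m) (u \<bullet> \<phi> m) (v \<bullet> \<phi> m)\<bar>
        \<le> (u \<bullet> \<phi> m)\<^sup>2 / 2 + 1 / (\<omega> 0)\<^sup>2 * ((v \<bullet> \<phi> m)\<^sup>2 / 2)" by linarith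
  qed
  also have "\<dots> = (\<Sum>m\<in>A. (u \<bullet> \<phi> m)\<^sup>2) / 2 + 1 / (\<omega> 0)\<^sup>2 * ((\<Sum>m\<in>A. (v \<bullet> \<phi> m)\<^sup>2) / 2)"
    by (simp add: sum.distrib sum_distrib_left sum_divide_distrib)
  also have "\<dots> \<le> (norm u)\<^sup>2 / 2 + 1 / (\<omega> 0)\<^sup>2 * ((norm v)\<^sup>2 / 2)"
    using bessel[OF assms, of u] bessel[OF assms, of v]
    by (intro add_mono divide_right_mono mult_left_mono) auto
  finally show ?thesis .
qed

text \<open>
  The sum over the modes and the integral over time may be exchanged by dominated convergence, as the
  partial sums of the Lagrangian are bounded by the full potential and kinetic energies.
\<close>

lemma action_sums:
  assumes \<xi>: "\<xi> \<in> X1" and w: "w \<in> L2_X1 X1 S T"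
  shows "(\<lambda>m. LINT s:{0..T}|lborel. osc_lagrangian (\<omega> m)
      (coord \<xi> m + (LINT \<sigma>:{0..s}|lborel. velocity T w \<sigma> \<bullet> \<phi> m)) (velocity T w s \<bullet> \<phi> m))
    sums action S \<mu> T \<xi> w"
proof -
  let ?V = "velocity T w"
  define U where "U = (\<lambda>s. S \<xi> + (LINT \<sigma>:{0..s}|lborel. ?V \<sigma>))"
  let ?L = "\<lambda>s. (norm (U s))\<^sup>2 / 2 - ((norm (Sinv (?V s)))\<^sup>2 / 2 + \<mu>\<^sup>2 / 2 * (norm (?V s))\<^sup>2)"
  let ?l = "\<lambda>m s. osc_lagrangian (\<omega> m) (U s \<bullet> \<phi> m) (?V s \<bullet> \<phi> m)"
  let ?B = "\<lambda>s. (norm (U s))\<^sup>2 / 2 + 1 / (\<omega> 0)\<^sup>2 * ((norm (?V s))\<^sup>2 / 2)"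
  have V: "sq_integrable T ?V" by (rule sq_integrable_velocity[OF w])
  have U: "sq_integrable T U" unfolding U_def by (rule sq_integrable_primitive[OF V])
  have [measurable]: "?V \<in> borel_measurable borel" "U \<in> borel_measurable borel"
    using U V by (auto simp: sq_integrable_def)
  have [measurable]: "Sinv \<in> borel_measurable borel"
    by (intro borel_measurable_continuous_onI linear_continuous_on bounded_linear_Sinv)
  have B: "set_integrable lborel {0..T} ?B"
    using U V by (intro set_integral_add set_integrable_divide set_integrable_mult_right)
      (auto simp: sq_integrable_def)
  have l: "set_integrable lborel {0..T} (?l m)" for m
  proof (rule set_integrable_dominated[OF B])
    show "?l m \<in> borel_measurable lborel" unfolding osc_lagrangian_def by measurable
    show "norm (?l m s) \<le> ?B s" for s
      using lagrangian_sum_le[of "{m}" "U s" "?V s"] by simp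
  qed simp
  have "(\<lambda>N. LINT s:{0..T}|lborel. \<Sum>m<N. ?l m s) \<longlonglongrightarrow> (LINT s:{0..T}|lborel. ?L s)"
    unfolding set_lebesgue_integral_def
  proof (rule integral_dominated_convergence)
    show "integrable lborel (\<lambda>s. indicator {0..T} s *\<^sub>R ?B s)" using B by (simp add: set_integrable_def)
    show "(\<lambda>s. indicator {0..T} s *\<^sub>R ?L s) \<in> borel_measurable lborel" by measurable
    show "(\<lambda>s. indicator {0..T} s *\<^sub>R (\<Sum>m<N. ?l m s)) \<in> borel_measurable lborel" for N
      unfolding osc_lagrangian_def by measurable
    show "AE s in lborel. (\<lambda>N. indicator {0..T} s *\<^sub>R (\<Sum>m<N. ?l m s)) \<longlonglongrightarrow> indicator {0..T} s *\<^sub>R ?L s"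
      by (intro AE_I2 tendsto_scaleR tendsto_const lagrangian_sums[unfolded sums_def])
    show "AE s in lborel. norm (indicator {0..T} s *\<^sub>R (\<Sum>m<N. ?l m s)) \<le> indicator {0..T} s *\<^sub>R ?B s" for N
      using lagrangian_sum_le[OF finite_lessThan] by (intro AE_I2) (auto simp: indicator_def)
  qed
  moreover have "(LINT s:{0..T}|lborel. \<Sum>m<N. ?l m s) = (\<Sum>m<N. LINT s:{0..T}|lborel. ?l m s)" for N
    unfolding set_lebesgue_integral_def scaleR_sum_right
    using l by (intro Bochner_Integration.integral_sum) (simp add: set_integrable_def)
  moreover have "(LINT s:{0..T}|lborel. ?L s) = action S \<mu> T \<xi> w"
    unfolding action_def
  proof (intro set_lebesgue_integral_cong ballI allI impI)
    fix s assume s: "s \<in> {0..T}"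
    then have "S (trajectory \<xi> w s) = U s" using trajectory_mem(2)[OF \<xi> w s] by (simp add: U_def)
    moreover have "?V s = S (w s)" "Sinv (?V s) = w s"
      using s w by (auto simp: velocity_def L2_X1_def Sinv_S)
    ultimately show "?L s = potential S (trajectory \<xi> w s) - kinetic S \<mu> (w s)"
      by (simp add: potential_def kinetic_def norm1_eq)
  qed simp
  moreover have "(LINT s:{0..T}|lborel. ?l m s) = (LINT s:{0..T}|lborel. osc_lagrangian (\<omega> m)
      (coord \<xi> m + (LINT \<sigma>:{0..s}|lborel. ?V \<sigma> \<bullet> \<phi> m)) (?V s \<bullet> \<phi> m))" for m
  proof (intro set_lebesgue_integral_cong ballI allI impI)
    fix s assume "s \<in> {0..T}"
    then have "set_integrable lborel {0..s} ?V"
      by (intro set_integrable_subset[OF sq_integrable_set_integrable[OF V]]) auto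
    from inner_set_integral[OF this, of "\<phi> m"]
    show "?l m s = osc_lagrangian (\<omega> m)
      (coord \<xi> m + (LINT \<sigma>:{0..s}|lborel. ?V \<sigma> \<bullet> \<phi> m)) (?V s \<bullet> \<phi> m)"
      by (simp add: U_def inner_add_left)
  qed simp
  ultimately show ?thesis by (simp add: sums_def)
qed

text \<open>
  All frequencies are below \<open>1 / \<mu>\<close>: this is where the bound \<open>\<mu> * sqrt 2\<close> on the horizon comes
  from, which makes Poincare's inequality sufficient and keeps the phases \<open>w * T\<close> below \<open>pi\<close>.
\<close>

lemma short_horizon:
  assumes "0 < T" "T < \<mu> * sqrt 2"
  shows "(\<omega> m)\<^sup>2 * T\<^sup>2 \<le> 2" and "sin (\<omega> m * T) \<noteq> 0"
proof -
  have "T\<^sup>2 \<le> (\<mu> * sqrt 2)\<^sup>2" using assms by (intro power_mono) auto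
  then have "T\<^sup>2 \<le> 2 * \<mu>\<^sup>2" by (simp add: power_mult_distrib)
  also have "\<dots> \<le> 2 * (1 / (\<omega> m)\<^sup>2)" using freq_inverse_bounds(1)[of m] by simp
  finally show le: "(\<omega> m)\<^sup>2 * T\<^sup>2 \<le> 2" using freq_pos[of m] by (simp add: field_simps)
  have "\<omega> m * T < 2"
  proof (rule power2_less_imp_less)
    show "(\<omega> m * T)\<^sup>2 < 2\<^sup>2" using le by (simp add: power_mult_distrib)
  qed simp
  then have "sin (\<omega> m * T) > 0"
    using pi_gt3 freq_pos[of m] assms(1) by (intro sin_gt_zero) auto
  then show "sin (\<omega> m * T) \<noteq> 0" by simp
qed

lemma action_le_G_long:
  assumes T: "0 < T" "T < \<mu> * sqrt 2" and res: "nonresonant T"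
    and \<xi>: "\<xi> \<in> X1" and w: "w \<in> L2_X1 X1 S T" and target: "trajectory \<xi> w T = \<zeta>"
  shows "action S \<mu> T \<xi> w \<le> G_long X1 S \<phi> lam \<mu> T \<xi> \<zeta>"
proof (rule sums_le[OF _ action_sums[OF \<xi> w] G_long_sums[OF res]])
  fix m
  let ?V = "velocity T w"
  have V: "sq_integrable T ?V" by (rule sq_integrable_velocity[OF w])
  have [measurable]: "?V \<in> borel_measurable borel" using V by (simp add: sq_integrable_def)
  have "sq_integrable T (\<lambda>s. ?V s \<bullet> \<phi> m)"
    unfolding sq_integrable_def
  proof
    show "set_integrable lborel {0..T} (\<lambda>s. (norm (?V s \<bullet> \<phi> m))\<^sup>2)"
    proof (rule set_integrable_dominated)
      show "set_integrable lborel {0..T} (\<lambda>s. (norm (?V s))\<^sup>2)" using V by (simp add: sq_integrable_def)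
      show "norm ((norm (?V s \<bullet> \<phi> m))\<^sup>2) \<le> (norm (?V s))\<^sup>2" for s
        using bessel[of "{m}" "?V s"] by simp
    qed measurable
  qed measurable
  moreover have "coord \<xi> m + (LINT \<sigma>:{0..T}|lborel. ?V \<sigma> \<bullet> \<phi> m) = coord \<zeta> m"
    using trajectory_mem(2)[OF \<xi> w, of T] T(1) inner_set_integral[OF sq_integrable_set_integrable[OF V]]
    by (simp add: target inner_add_left)
  ultimately show "(LINT s:{0..T}|lborel. osc_lagrangian (\<omega> m)
      (coord \<xi> m + (LINT \<sigma>:{0..s}|lborel. ?V \<sigma> \<bullet> \<phi> m)) (?V s \<bullet> \<phi> m))
      \<le> mode_kernel (\<omega> m) T (coord \<xi> m) (coord \<zeta> m)"
    using freq_pos T short_horizon[OF T] by (intro osc_action_le) auto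
qed

text \<open>
  The classical paths of the single modes fit together to an admissible path, because their
  velocities are bounded, uniformly in time, by a multiple of the coordinates of the end points.
\<close>

lemma optimal_velocity:
  assumes res: "nonresonant T" and "0 \<le> T" and \<xi>: "\<xi> \<in> X1" and \<zeta>: "\<zeta> \<in> X1"
  obtains w where "w \<in> L2_X1 X1 S T" "trajectory \<xi> w T = \<zeta>"
    "action S \<mu> T \<xi> w = G_long X1 S \<phi> lam \<mu> T \<xi> \<zeta>"
proof -
  let ?p = "\<lambda>m. osc_vel (\<omega> m) T (coord \<xi> m) (coord \<zeta> m)"
  obtain K where K: "K > 0" "\<And>m. \<bar>1 / sin (\<omega> m * T)\<bar> \<le> K"
    using nonresonant_inverse_sin[OF res] by blast
  define M where "M = 2 * (1 / \<mu> * K)\<^sup>2"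
  have bound: "(?p m s)\<^sup>2 \<le> M * ((coord \<xi> m)\<^sup>2 + (coord \<zeta> m)\<^sup>2)" for m s
  proof -
    have f: "\<bar>\<omega> m * (1 / sin (\<omega> m * T))\<bar> \<le> 1 / \<mu> * K"
      unfolding abs_mult
      by (intro mult_mono K(2)) (use freq_pos[of m] freq_le[of m] mu_pos in \<open>simp_all del: abs_divide\<close>)
    have c: "\<bar>coord \<zeta> m * cos (\<omega> m * s) - coord \<xi> m * cos (\<omega> m * (T - s))\<bar> \<le> \<bar>coord \<xi> m\<bar> + \<bar>coord \<zeta> m\<bar>"
    proof -
      have "\<bar>x * cos y\<bar> \<le> \<bar>x\<bar>" for x y :: real
        unfolding abs_mult by (intro mult_left_le abs_cos_le_one abs_ge_zero)
      from this[of "coord \<zeta> m" "\<omega> m * s"] this[of "coord \<xi> m" "\<omega> m * (T - s)"]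
      show ?thesis by linarith
    qed
    have "\<bar>?p m s\<bar> = \<bar>\<omega> m * (1 / sin (\<omega> m * T))\<bar>
        * \<bar>coord \<zeta> m * cos (\<omega> m * s) - coord \<xi> m * cos (\<omega> m * (T - s))\<bar>"
      by (simp add: osc_vel_def abs_mult)
    also have "\<dots> \<le> (1 / \<mu> * K) * (\<bar>coord \<xi> m\<bar> + \<bar>coord \<zeta> m\<bar>)"
      by (intro mult_mono f c mult_nonneg_nonneg) (use mu_pos K(1) in simp_all)
    finally have "\<bar>?p m s\<bar>\<^sup>2 \<le> ((1 / \<mu> * K) * (\<bar>coord \<xi> m\<bar> + \<bar>coord \<zeta> m\<bar>))\<^sup>2"
      by (rule power_mono) simp
    then have "(?p m s)\<^sup>2 \<le> (1 / \<mu> * K)\<^sup>2 * (\<bar>coord \<xi> m\<bar> + \<bar>coord \<zeta> m\<bar>)\<^sup>2"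
      unfolding power_mult_distrib power2_abs .
    also have "\<dots> \<le> (1 / \<mu> * K)\<^sup>2 * (2 * ((coord \<xi> m)\<^sup>2 + (coord \<zeta> m)\<^sup>2))"
    proof (rule mult_left_mono)
      show "(\<bar>coord \<xi> m\<bar> + \<bar>coord \<zeta> m\<bar>)\<^sup>2 \<le> 2 * ((coord \<xi> m)\<^sup>2 + (coord \<zeta> m)\<^sup>2)"
      proof -
        have "(x + y)\<^sup>2 \<le> 2 * (x\<^sup>2 + y\<^sup>2)" for x y :: real
          using sum_squares_bound[of x y] unfolding power2_sum by simp
        from this[of "\<bar>coord \<xi> m\<bar>" "\<bar>coord \<zeta> m\<bar>"] show ?thesis unfolding power2_abs .
      qed
    qed simp
    also have "\<dots> = M * ((coord \<xi> m)\<^sup>2 + (coord \<zeta> m)\<^sup>2)" by (simp only: M_def mult_ac)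
    finally show ?thesis .
  qed
  have bsum: "(\<lambda>m. M * ((coord \<xi> m)\<^sup>2 + (coord \<zeta> m)\<^sup>2)) sums (M * ((norm (S \<xi>))\<^sup>2 + (norm (S \<zeta>))\<^sup>2))"
    by (intro sums_mult sums_add parseval_norm)
  have summ: "summable (\<lambda>m. (?p m s)\<^sup>2)" for s
    using bound by (intro summable_comparison_test'[OF sums_summable[OF bsum]]) simp
  define V where "V = (\<lambda>s. \<Sum>m. ?p m s *\<^sub>R \<phi> m)"
  have Vsums: "(\<lambda>m. ?p m s *\<^sub>R \<phi> m) sums V s" for s
    unfolding V_def using summable_basis_series[OF summ] by (rule summable_sums)
  have Vc: "V s \<bullet> \<phi> m = ?p m s" for s m by (rule sums_inner_basis[OF Vsums])
  have Vm: "V \<in> borel_measurable lborel"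
  proof (rule borel_measurable_LIMSEQ_metric)
    show "(\<lambda>s. \<Sum>m<N. ?p m s *\<^sub>R \<phi> m) \<in> borel_measurable lborel" for N
      using borel_measurable_continuous_onI[OF continuous_osc_vel]
      by (intro borel_measurable_sum borel_measurable_scaleR) auto
    show "(\<lambda>N. \<Sum>m<N. ?p m s *\<^sub>R \<phi> m) \<longlonglongrightarrow> V s" for s
      using Vsums[of s] by (simp add: sums_def)
  qed
  have Vn: "(norm (V s))\<^sup>2 \<le> M * ((norm (S \<xi>))\<^sup>2 + (norm (S \<zeta>))\<^sup>2)" for s
    using sums_le[OF _ parseval_norm bsum, of "V s"] bound by (simp add: Vc)
  have V: "sq_integrable T V"
    using Vm Vn by (intro sq_integrable_bounded) (auto intro: real_le_rsqrt)
  define w where "w = (\<lambda>s. Sinv (V s))"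
  have w: "w \<in> L2_X1 X1 S T"
    unfolding L2_X1_def set_borel_measurable_def w_def norm1_eq S_Sinv mem_Collect_eq
  proof (intro conjI ballI Sinv_mem)
    show "(\<lambda>s. indicat_real {0..T} s *\<^sub>R V s) \<in> borel_measurable lborel"
      by (intro borel_measurable_scaleR Vm) simp
    show "set_integrable lborel {0..T} (\<lambda>s. (norm (V s))\<^sup>2)" using V by (simp add: sq_integrable_def)
  qed
  have vel: "velocity T w s \<bullet> \<phi> m = ?p m s" if "s \<in> {0..T}" for s m
    using that by (simp add: velocity_def w_def S_Sinv Vc)
  have path: "coord \<xi> m + (LINT \<sigma>:{0..s}|lborel. velocity T w \<sigma> \<bullet> \<phi> m)
      = osc_path (\<omega> m) T (coord \<xi> m) (coord \<zeta> m) s" if "s \<in> {0..T}" for s m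
  proof -
    have "(LINT \<sigma>:{0..s}|lborel. velocity T w \<sigma> \<bullet> \<phi> m) = (LINT \<sigma>:{0..s}|lborel. ?p m \<sigma>)"
      using that by (intro set_lebesgue_integral_cong) (auto simp: vel)
    then show ?thesis
      using that nonresonant_sin[OF res, of m] by (simp add: osc_vel_primitive osc_path_endpoints)
  qed
  have "trajectory \<xi> w T = \<zeta>"
  proof (rule coord_eqI)
    show "trajectory \<xi> w T \<in> X1" using \<open>0 \<le> T\<close> by (intro trajectory_mem(1)[OF \<xi> w]) simp
    show "coord (trajectory \<xi> w T) m = coord \<zeta> m" for m
      using trajectory_mem(2)[OF \<xi> w, of T] \<open>0 \<le> T\<close> path[of T m] nonresonant_sin[OF res, of m]
        inner_set_integral[OF sq_integrable_set_integrable[OF sq_integrable_velocity[OF w]]]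
      by (simp add: inner_add_left osc_path_endpoints)
  qed (rule \<zeta>)
  moreover have "action S \<mu> T \<xi> w = G_long X1 S \<phi> lam \<mu> T \<xi> \<zeta>"
  proof (rule sums_unique2[OF action_sums[OF \<xi> w]])
    have "(LINT s:{0..T}|lborel. osc_lagrangian (\<omega> m)
        (coord \<xi> m + (LINT \<sigma>:{0..s}|lborel. velocity T w \<sigma> \<bullet> \<phi> m)) (velocity T w s \<bullet> \<phi> m))
      = mode_kernel (\<omega> m) T (coord \<xi> m) (coord \<zeta> m)" for m
    proof -
      have "(LINT s:{0..T}|lborel. osc_lagrangian (\<omega> m)
          (coord \<xi> m + (LINT \<sigma>:{0..s}|lborel. velocity T w \<sigma> \<bullet> \<phi> m)) (velocity T w s \<bullet> \<phi> m))
        = (LINT s:{0..T}|lborel. osc_lagrangian (\<omega> m)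
            (osc_path (\<omega> m) T (coord \<xi> m) (coord \<zeta> m) s) (?p m s))"
        by (intro set_lebesgue_integral_cong) (auto simp: vel path)
      then show ?thesis
        using osc_path_action[of "\<omega> m" T] freq_pos[of m] \<open>0 \<le> T\<close> nonresonant_sin[OF res, of m] by simp
    qed
    then show "(\<lambda>m. LINT s:{0..T}|lborel. osc_lagrangian (\<omega> m)
        (coord \<xi> m + (LINT \<sigma>:{0..s}|lborel. velocity T w \<sigma> \<bullet> \<phi> m)) (velocity T w s \<bullet> \<phi> m))
      sums G_long X1 S \<phi> lam \<mu> T \<xi> \<zeta>"
      using G_long_sums[OF res] by simp
  qed
  ultimately show thesis using that w by blast
qed

lemma G_short_eq_G_long:
  assumes T: "0 < T" "T < \<mu> * sqrt 2" and res: "nonresonant T"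
    and \<xi>: "\<xi> \<in> X1" and \<zeta>: "\<zeta> \<in> X1"
  shows "G_short X1 S \<mu> T \<xi> \<zeta> = G_long X1 S \<phi> lam \<mu> T \<xi> \<zeta>"
  unfolding G_short_def
proof (rule cSup_eq_maximum)
  obtain w where "w \<in> L2_X1 X1 S T" "trajectory \<xi> w T = \<zeta>"
    "action S \<mu> T \<xi> w = G_long X1 S \<phi> lam \<mu> T \<xi> \<zeta>"
    by (rule optimal_velocity[OF res _ \<xi> \<zeta>, of thesis]) (use T(1) in auto)
  then show "G_long X1 S \<phi> lam \<mu> T \<xi> \<zeta> \<in> {action S \<mu> T \<xi> w |w. w \<in> L2_X1 X1 S T \<and> trajectory \<xi> w T = \<zeta>}"
    by (intro CollectI exI[of _ w]) simp
qed (auto intro: action_le_G_long[OF T res \<xi>])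

end

section \<open>Concatenation of horizons for a single mode\<close>

lemma osc_path_shift:
  assumes "w \<noteq> 0"
  shows "osc_path w T a b (s + r) = cos (w * r) * osc_path w T a b s + sin (w * r) / w * osc_vel w T a b s"
proof -
  have arg: "w * (T - (s + r)) = w * (T - s) - w * r" "w * (s + r) = w * s + w * r"
    by (simp_all add: algebra_simps)
  show ?thesis unfolding osc_path_def osc_vel_def arg sin_diff sin_add using assms
    by (simp add: add_divide_distrib diff_divide_distrib algebra_simps)
qed

text \<open>
  The derivatives of the kernel of a single mode in its end points are, up to the factor
  \<open>1 / w\<^sup>2\<close>, the initial velocity and the negative of the final velocity of the classical path.
\<close>

lemma kernel_gradient_on_path:
  assumes "w \<noteq> 0" "sin (w * r) \<noteq> 0"
  shows "pcoef w r * osc_path w T a b s + qcoef w r * osc_path w T a b (s + r) = osc_vel w T a b s / w\<^sup>2"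
    and "pcoef w r * osc_path w T a b (s + r) + qcoef w r * osc_path w T a b s = - osc_vel w T a b (s + r) / w\<^sup>2"
proof -
  show "pcoef w r * osc_path w T a b s + qcoef w r * osc_path w T a b (s + r) = osc_vel w T a b s / w\<^sup>2"
    unfolding osc_path_shift[OF assms(1), of T a b s r] pcoef_cos qcoef_def using assms
    by (simp add: field_simps power2_eq_square)
  have "osc_path w T a b s = cos (w * r) * osc_path w T a b (s + r) - sin (w * r) / w * osc_vel w T a b (s + r)"
    using osc_path_shift[OF assms(1), of T a b "s + r" "- r"] by simp
  then have "osc_path w T a b s - cos (w * r) * osc_path w T a b (s + r)
      = - (sin (w * r) / w * osc_vel w T a b (s + r))" by simp
  moreover have "pcoef w r * osc_path w T a b (s + r) + qcoef w r * osc_path w T a b s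
      = (osc_path w T a b s - cos (w * r) * osc_path w T a b (s + r)) / (w * sin (w * r))"
    by (simp add: pcoef_cos qcoef_def diff_divide_distrib)
  ultimately show "pcoef w r * osc_path w T a b (s + r) + qcoef w r * osc_path w T a b s
      = - osc_vel w T a b (s + r) / w\<^sup>2"
    using assms by (simp add: power2_eq_square)
qed

lemma mode_on_path:
  assumes "w \<noteq> 0" "sin (w * r) \<noteq> 0"
  shows "mode_kernel w r (osc_path w T a b s) (osc_path w T a b (s + r))
    = (osc_path w T a b s * osc_vel w T a b s - osc_path w T a b (s + r) * osc_vel w T a b (s + r)) / (2 * w\<^sup>2)"
proof -
  have *: "mode_kernel w r A B = (A * (pcoef w r * A + qcoef w r * B) + B * (pcoef w r * B + qcoef w r * A)) / 2" for A B
    by (simp add: mode_kernel_def power2_eq_square algebra_simps add_divide_distrib)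
  show ?thesis unfolding * kernel_gradient_on_path[OF assms] by (simp add: diff_divide_distrib)
qed

lemma mode_additive_on_path:
  assumes "w \<noteq> 0" "sin (w * r) \<noteq> 0" "sin (w * T) \<noteq> 0" "T = real n * r"
  shows "(\<Sum>k<n. mode_kernel w r (osc_path w T a b (real k * r)) (osc_path w T a b (real (Suc k) * r))) = mode_kernel w T a b"
proof -
  let ?e = "\<lambda>s. osc_path w T a b s * osc_vel w T a b s / (2 * w\<^sup>2)"
  have "mode_kernel w r (osc_path w T a b (real k * r)) (osc_path w T a b (real (Suc k) * r))
      = ?e (real k * r) - ?e (real (Suc k) * r)" for k
    using mode_on_path[OF assms(1,2), of T a b "real k * r"] by (simp add: algebra_simps diff_divide_distrib)
  then have "(\<Sum>k<n. mode_kernel w r (osc_path w T a b (real k * r)) (osc_path w T a b (real (Suc k) * r)))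
      = (\<Sum>k<n. ?e (real k * r) - ?e (real (Suc k) * r))" by simp
  also have "\<dots> = ?e 0 - ?e T"
    unfolding sum_lessThan_telescope'[of "\<lambda>k. ?e (real k * r)"] by (simp add: assms(4))
  also have "\<dots> = mode_kernel w T a b"
    using osc_boundary_value[OF assms(1,3), of b a] osc_path_endpoints[OF assms(3), of a b]
    by (simp add: diff_divide_distrib)
  finally show ?thesis .
qed

text \<open>
  Starting from \<open>x 0 = 0\<close>, the recursion forces \<open>x i\<close> to be a multiple of \<open>sin (i * \<theta>)\<close>.
\<close>

lemma chebyshev_recursion_zero:
  fixes x :: "nat \<Rightarrow> real"
  assumes rec: "\<And>i. 1 \<le> i \<Longrightarrow> i < n \<Longrightarrow> x (i - 1) + x (i + 1) = 2 * cos \<theta> * x i"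
    and "x 0 = 0" "x n = 0" "sin \<theta> \<noteq> 0" "sin (real n * \<theta>) \<noteq> 0" and "i \<le> n"
  shows "x i = 0"
proof -
  have *: "i \<le> n \<Longrightarrow> sin \<theta> * x i = x 1 * sin (real i * \<theta>)" for i
  proof (induction i rule: less_induct)
    case (less i)
    consider "i = 0" | "i = 1" | j where "i = Suc (Suc j)" by (metis One_nat_def not0_implies_Suc)
    then show ?case
    proof cases
      case 3
      have "x i = 2 * cos \<theta> * x (Suc j) - x j" using rec[of "Suc j"] less.prems 3 by simp
      then have "sin \<theta> * x i = 2 * cos \<theta> * (sin \<theta> * x (Suc j)) - sin \<theta> * x j"
        by (simp only: right_diff_distrib mult_ac)
      also have "\<dots> = x 1 * (2 * cos \<theta> * sin (real (Suc j) * \<theta>) - sin (real j * \<theta>))"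
        using less.IH[of j] less.IH[of "Suc j"] less.prems 3 by (simp add: algebra_simps)
      also have "2 * cos \<theta> * sin (real (Suc j) * \<theta>) - sin (real j * \<theta>) = sin (real i * \<theta>)"
      proof -
        have "sin (real i * \<theta>) = sin (real (Suc j) * \<theta> + \<theta>)" "sin (real j * \<theta>) = sin (real (Suc j) * \<theta> - \<theta>)"
          using 3 by (simp_all add: algebra_simps)
        then show ?thesis by (simp add: sin_add sin_diff)
      qed
      finally show ?thesis .
    qed (use assms(2) in auto)
  qed
  have "x 1 = 0" using *[of n] assms(3,5) by simp
  then show ?thesis using *[OF \<open>i \<le> n\<close>] assms(4) by simp
qed

section \<open>Stationarity over one intermediate point\<close>

context kernel_space
begin

lemma coord_add: "x \<in> X1 \<Longrightarrow> y \<in> X1 \<Longrightarrow> coord (x + y) m = coord x m + coord y m"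
  by (simp add: S_add inner_add_left)

lemma coord_minus: "x \<in> X1 \<Longrightarrow> coord (- x) m = - coord x m"
  using S_scale[of x "-1"] by simp

lemma diagonal_exists:
  assumes "\<And>m. \<bar>p m\<bar> \<le> K"
  obtains y where "y \<in> X1" "\<And>m. coord y m = p m * coord x m"
  by (rule coord_exists[OF summable_bounded_mult[of p K x, OF assms]]) (rule that)

lemma coord_bump:
  assumes "z \<in> X1"
  obtains y where "y \<in> X1" "\<And>k. coord y k = coord z k + (if k = m then e else 0)"
proof
  show "z + e *\<^sub>R phi1 \<phi> lam m \<in> X1"
    using assms S_phi1[of m] X1_subspace by (simp add: subspace_add subspace_scale)
  show "coord (z + e *\<^sub>R phi1 \<phi> lam m) k = coord z k + (if k = m then e else 0)" for k
    using assms S_phi1[of m] X1_subspace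
    by (simp add: coord_add subspace_scale S_scale basis_inner)
qed

lemma path_point_exists:
  assumes "nonresonant T"
  obtains x where "x \<in> X1" "\<And>m. coord x m = osc_path (\<omega> m) T (coord \<xi> m) (coord \<zeta> m) s"
proof -
  obtain K where K: "K > 0" "\<And>m. \<bar>1 / sin (\<omega> m * T)\<bar> \<le> K"
    using nonresonant_inverse_sin[OF assms] by blast
  have b: "\<bar>sin r * (1 / sin (\<omega> m * T))\<bar> \<le> K" for m r
    unfolding abs_mult using mult_mono[OF abs_sin_le_one[of r] K(2)[of m]] by simp
  obtain y1 where "y1 \<in> X1" "\<And>m. coord y1 m = sin (\<omega> m * (T - s)) * (1 / sin (\<omega> m * T)) * coord \<xi> m"
    by (rule diagonal_exists[OF b]) (rule that)
  moreover obtain y2 where "y2 \<in> X1" "\<And>m. coord y2 m = sin (\<omega> m * s) * (1 / sin (\<omega> m * T)) * coord \<zeta> m"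
    by (rule diagonal_exists[OF b]) (rule that)
  ultimately show thesis
    using X1_subspace by (intro that[of "y1 + y2"])
      (simp_all add: subspace_add coord_add osc_path_def add_divide_distrib mult_ac)
qed

lemma pcoef_sum:
  assumes "nonresonant s" "nonresonant r"
  shows "pcoef (\<omega> m) s + pcoef (\<omega> m) r = - sin (\<omega> m * (s + r)) / (\<omega> m * sin (\<omega> m * s) * sin (\<omega> m * r))"
  using nonresonant_sin[OF assms(1), of m] nonresonant_sin[OF assms(2), of m] freq_pos[of m]
  by (simp add: pcoef_cos qcoef_def sin_add distrib_left field_simps)

text \<open>
  The coefficient \<open>c\<close> of \<open>M\<close> in each mode is bounded away from zero because its reciprocal is a product
  of bounded factors over \<open>sin (\<omega> m * (s + r))\<close>, so \<open>M\<close> is a bijection and the equation for the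
  stationary point has one solution.  That solution is the point at time \<open>s\<close> of the classical path
  over the horizon \<open>s + r\<close>: there the final velocity of the first leg equals the initial velocity of
  the second.
\<close>

lemma two_leg_stationary:
  assumes s: "nonresonant s" and r: "nonresonant r" and t: "nonresonant (s + r)"
    and \<xi>: "\<xi> \<in> X1" and \<zeta>: "\<zeta> \<in> X1"
  defines "F \<equiv> \<lambda>\<eta>. G_long X1 S \<phi> lam \<mu> s \<xi> \<eta> + G_long X1 S \<phi> lam \<mu> r \<eta> \<zeta>"
    and "M \<equiv> \<lambda>\<eta>. P_op X1 S \<phi> lam \<mu> s \<eta> + P_op X1 S \<phi> lam \<mu> r \<eta>"
    and "y \<equiv> Q_op X1 S \<phi> lam \<mu> s \<xi> + Q_op X1 S \<phi> lam \<mu> r \<zeta>"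
  shows "bij_betw M X1 X1" and "- inv_into X1 M y \<in> X1"
    and "argstat X1 (dist1 S) F = {- inv_into X1 M y}"
    and "F (- inv_into X1 M y) = G_long X1 S \<phi> lam \<mu> (s + r) \<xi> \<zeta>"
proof -
  define c where "c = (\<lambda>m. pcoef (\<omega> m) s + pcoef (\<omega> m) r)"
  have c_nz: "c m \<noteq> 0" for m
    unfolding c_def pcoef_sum[OF s r] using nonresonant_sin s r t freq_pos[of m] by auto
  obtain K where K: "K > 0" "\<And>m. \<bar>1 / sin (\<omega> m * (s + r))\<bar> \<le> K"
    using nonresonant_inverse_sin[OF t] by blast
  have c_inv: "\<bar>1 / c m\<bar> \<le> 1 / \<mu> * K" for m
  proof -
    have "\<bar>1 / c m\<bar> = (\<omega> m * (\<bar>sin (\<omega> m * s)\<bar> * \<bar>sin (\<omega> m * r)\<bar>)) * \<bar>1 / sin (\<omega> m * (s + r))\<bar>"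
      unfolding c_def pcoef_sum[OF s r] using freq_pos[of m] by (simp add: abs_mult)
    also have "\<dots> \<le> (1 / \<mu> * (1 * 1)) * K"
      using freq_pos[of m] freq_le[of m] mu_pos
      by (intro mult_mono K(2) abs_sin_le_one mult_nonneg_nonneg) auto
    finally show ?thesis by simp
  qed
  have M_mem: "M x \<in> X1" if "x \<in> X1" for x
    using P_op_coord(1)[OF s] P_op_coord(1)[OF r] X1_subspace by (simp add: M_def subspace_add)
  have M_coord: "coord (M x) m = c m * coord x m" if "x \<in> X1" for x m
    unfolding M_def c_def using P_op_coord[OF s] P_op_coord[OF r] by (simp add: coord_add distrib_right)
  show bij: "bij_betw M X1 X1"
  proof (intro bij_betw_imageI inj_onI set_eqI iffI)
    fix x x' assume "x \<in> X1" "x' \<in> X1" "M x = M x'"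
    then show "x = x'" using M_coord c_nz by (metis coord_eqI mult_left_cancel)
  next
    fix u assume u: "u \<in> X1"
    obtain x where x: "x \<in> X1" "\<And>m. coord x m = 1 / c m * coord u m"
      by (rule diagonal_exists[OF c_inv]) (rule that)
    have "u = M x" using x u M_mem c_nz by (intro coord_eqI) (simp_all add: M_coord)
    then show "u \<in> M ` X1" using x(1) by blast
  qed (use M_mem in auto)
  obtain z where z: "z \<in> X1" "\<And>m. coord z m = osc_path (\<omega> m) (s + r) (coord \<xi> m) (coord \<zeta> m) s"
    by (rule path_point_exists[OF t]) (rule that)
  have y_mem: "y \<in> X1" and y_coord: "coord y m = qcoef (\<omega> m) s * coord \<xi> m + qcoef (\<omega> m) r * coord \<zeta> m" for m
    using Q_op_coord[OF s] Q_op_coord[OF r] X1_subspace by (simp_all add: y_def subspace_add coord_add)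
  have endp: "osc_path (\<omega> m) (s + r) (coord \<xi> m) (coord \<zeta> m) 0 = coord \<xi> m"
    "osc_path (\<omega> m) (s + r) (coord \<xi> m) (coord \<zeta> m) (s + r) = coord \<zeta> m" for m
    using nonresonant_sin[OF t, of m] by (simp_all add: osc_path_endpoints)
  have crit: "c m * coord z m + coord y m = 0" for m
    using kernel_gradient_on_path(1)[of "\<omega> m" r "s + r" "coord \<xi> m" "coord \<zeta> m" s]
      kernel_gradient_on_path(2)[of "\<omega> m" s "s + r" "coord \<xi> m" "coord \<zeta> m" 0]
      nonresonant_sin[OF s, of m] nonresonant_sin[OF r, of m] freq_pos[of m]
    by (simp add: z(2) y_coord c_def endp distrib_right)
  have "M (- z) = y"
  proof (rule coord_eqI)
    fix m
    show "coord (M (- z)) m = coord y m"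
      using crit[of m] z(1) X1_subspace by (simp add: M_coord coord_minus subspace_neg)
  qed (use M_mem z(1) X1_subspace y_mem in \<open>simp_all add: subspace_neg\<close>)
  then have star: "- inv_into X1 M y = z"
    using bij_betw_imp_inj_on[OF bij] z(1) X1_subspace by (metis inv_into_f_f minus_minus subspace_neg)
  show "- inv_into X1 M y \<in> X1" using star z(1) by simp
  obtain K1 where K1: "K1 > 0" "\<And>m. \<bar>pcoef (\<omega> m) s\<bar> \<le> K1" by (rule coef_bounds[OF s]) (rule that)
  obtain K2 where K2: "K2 > 0" "\<And>m. \<bar>pcoef (\<omega> m) r\<bar> \<le> K2" by (rule coef_bounds[OF r]) (rule that)
  have "argstat X1 (dist1 S) F = {x \<in> X1. \<forall>m. \<forall>i\<in>{()}. c m * coord x m + coord y m = 0}"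
  proof (rule argstat_modewise[where cc = "\<lambda>x m _. coord x m" and C = "(K1 + K2) / 2"
        and q = "\<lambda>m x. mode_kernel (\<omega> m) s (coord \<xi> m) (x ()) + mode_kernel (\<omega> m) r (x ()) (coord \<zeta> m)"
        and D = "\<lambda>m x i. c m * x i + coord y m"])
    show "0 \<le> dist1 S x x'" if "x \<in> X1" "x' \<in> X1" for x x' using that by (simp add: dist1_eq)
    show "(\<lambda>m. \<Sum>i\<in>{()}. (coord x m - coord x' m)\<^sup>2) sums (dist1 S x x')\<^sup>2" if "x \<in> X1" "x' \<in> X1" for x x'
      using dist1_sums[OF that] by simp
    show "(\<lambda>m. mode_kernel (\<omega> m) s (coord \<xi> m) (coord x m) + mode_kernel (\<omega> m) r (coord x m) (coord \<zeta> m)) sums F x" for x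
      unfolding F_def by (intro sums_add G_long_sums s r)
    show "\<bar>mode_kernel (\<omega> m) s (coord \<xi> m) (x' ()) + mode_kernel (\<omega> m) r (x' ()) (coord \<zeta> m)
        - (mode_kernel (\<omega> m) s (coord \<xi> m) (x ()) + mode_kernel (\<omega> m) r (x ()) (coord \<zeta> m))
        - (\<Sum>i\<in>{()}. (c m * x i + coord y m) * (x' i - x i))\<bar>
      \<le> (K1 + K2) / 2 * (\<Sum>i\<in>{()}. (x' i - x i)\<^sup>2)" for m and x x' :: "unit \<Rightarrow> real"
    proof -
      have eq: "mode_kernel (\<omega> m) s (coord \<xi> m) (x' ()) + mode_kernel (\<omega> m) r (x' ()) (coord \<zeta> m)
        - (mode_kernel (\<omega> m) s (coord \<xi> m) (x ()) + mode_kernel (\<omega> m) r (x ()) (coord \<zeta> m))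
        - (\<Sum>i\<in>{()}. (c m * x i + coord y m) * (x' i - x i)) = c m / 2 * (x' () - x ())\<^sup>2"
        by (simp add: mode_kernel_def y_coord c_def power2_eq_square field_simps)
      have "\<bar>c m / 2 * (x' () - x ())\<^sup>2\<bar> \<le> (K1 + K2) / 2 * (x' () - x ())\<^sup>2"
      proof -
        have "\<bar>c m / 2\<bar> \<le> (K1 + K2) / 2" using K1(2)[of m] K2(2)[of m] by (simp add: c_def)
        from mult_right_mono[OF this, of "(x' () - x ())\<^sup>2"] show ?thesis by (simp add: abs_mult)
      qed
      then show ?thesis unfolding eq by simp
    qed
    show "\<exists>x\<in>X1. \<forall>m' (i'::unit). coord x m' = coord x' m' + (if m' = m \<and> i' = i then e else 0)"
      if x': "x' \<in> X1" for x' m i e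
    proof -
      obtain x where "x \<in> X1" "\<And>k. coord x k = coord x' k + (if k = m then e else 0)"
        by (rule coord_bump[OF x']) (rule that)
      then show ?thesis by (intro bexI[of _ x]) auto
    qed
  qed simp
  also have "\<dots> = {z}"
  proof (intro set_eqI iffI)
    fix x assume x: "x \<in> {x \<in> X1. \<forall>m. \<forall>i\<in>{()}. c m * coord x m + coord y m = 0}"
    have "coord x m = coord z m" for m
    proof -
      have "c m * coord x m + coord y m = 0" using x by simp
      with crit[of m] have "c m * coord x m = c m * coord z m" by linarith
      then show ?thesis using c_nz[of m] by simp
    qed
    then show "x \<in> {z}" using x z(1) coord_eqI by blast
  qed (use crit z(1) in auto)
  finally show "argstat X1 (dist1 S) F = {- inv_into X1 M y}" unfolding star .
  have "mode_kernel (\<omega> m) s (coord \<xi> m) (coord z m) + mode_kernel (\<omega> m) r (coord z m) (coord \<zeta> m)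
      = mode_kernel (\<omega> m) (s + r) (coord \<xi> m) (coord \<zeta> m)" for m
    using mode_on_path[of "\<omega> m" s "s + r" "coord \<xi> m" "coord \<zeta> m" 0]
      mode_on_path[of "\<omega> m" r "s + r" "coord \<xi> m" "coord \<zeta> m" s]
      osc_boundary_value[of "\<omega> m" "s + r" "coord \<zeta> m" "coord \<xi> m"]
      nonresonant_sin[OF s, of m] nonresonant_sin[OF r, of m] nonresonant_sin[OF t, of m] freq_pos[of m]
    by (simp add: z(2) endp diff_divide_distrib)
  moreover have "(\<lambda>m. mode_kernel (\<omega> m) s (coord \<xi> m) (coord z m) + mode_kernel (\<omega> m) r (coord z m) (coord \<zeta> m)) sums F z"
    unfolding F_def by (intro sums_add G_long_sums s r)
  ultimately show "F (- inv_into X1 M y) = G_long X1 S \<phi> lam \<mu> (s + r) \<xi> \<zeta>"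
    unfolding star using G_long_sums[OF t, of \<xi> \<zeta>] by (auto dest: sums_unique2)
qed

end

section \<open>Stationarity over a chain of intermediate points\<close>

text \<open>
  The interior points \<open>x 1, \<dots>, x (n - 1)\<close> completed by the fixed end points, so that the first and the
  last leg need no separate treatment.
\<close>

definition chain :: "nat \<Rightarrow> 'b \<Rightarrow> 'b \<Rightarrow> (nat \<Rightarrow> 'b) \<Rightarrow> nat \<Rightarrow> 'b" where
  "chain n a b x i = (if i = 0 then a else if i = n then b else x i)"

lemma chain_sum:
  fixes f :: "'b \<Rightarrow> 'b \<Rightarrow> real"
  assumes "2 \<le> n"
  shows "f a (x 1) + (\<Sum>k=2..n-1. f (x (k-1)) (x k)) + f (x (n-1)) b
    = (\<Sum>k<n. f (chain n a b x k) (chain n a b x (Suc k)))"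
proof -
  define N where "N = n - 2"
  have n: "n = Suc (Suc N)" using assms by (simp add: N_def)
  have "(\<Sum>k=2..Suc N. f (x (k-1)) (x k)) = (\<Sum>k<N. f (x (Suc k)) (x (Suc (Suc k))))"
    by (induction N) simp_all
  then have "(\<Sum>k=2..n-1. f (x (k-1)) (x k)) = (\<Sum>k<N. f (x (Suc k)) (x (Suc (Suc k))))"
    by (simp add: n)
  also have "\<dots> = (\<Sum>k<N. f (chain n a b x (Suc k)) (chain n a b x (Suc (Suc k))))"
    by (intro sum.cong) (auto simp: chain_def n)
  finally have mid: "(\<Sum>k=2..n-1. f (x (k-1)) (x k))
    = (\<Sum>k<N. f (chain n a b x (Suc k)) (chain n a b x (Suc (Suc k))))" .
  have "(\<Sum>k<Suc (Suc N). g k) = g 0 + (\<Sum>k<N. g (Suc k)) + g (Suc N)" for g :: "nat \<Rightarrow> real"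
    by (subst sum.lessThan_Suc) (simp only: sum.lessThan_Suc_shift)
  from this[of "\<lambda>k. f (chain n a b x k) (chain n a b x (Suc k))"]
  show ?thesis unfolding mid by (simp add: chain_def n del: sum.lessThan_Suc)
qed

lemma sum_interior:
  fixes f :: "nat \<Rightarrow> real"
  assumes "0 < n" "f 0 = 0" "f n = 0"
  shows "(\<Sum>k<n. f k) = (\<Sum>i=1..n-1. f i)" and "(\<Sum>k<n. f (Suc k)) = (\<Sum>i=1..n-1. f i)"
proof -
  obtain N where n: "n = Suc N" using assms(1) by (cases n) auto
  show "(\<Sum>k<n. f k) = (\<Sum>i=1..n-1. f i)"
    unfolding n sum.lessThan_Suc_shift using assms(2) by (simp add: sum.atLeast1_atMost_eq)
  show "(\<Sum>k<n. f (Suc k)) = (\<Sum>i=1..n-1. f i)"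
    using assms(3) by (simp add: n sum.atLeast1_atMost_eq)
qed

lemma mode_bound:
  assumes "\<bar>pcoef w r\<bar> \<le> K" "\<bar>qcoef w r\<bar> \<le> K"
  shows "\<bar>mode_kernel w r a b\<bar> \<le> K * (a\<^sup>2 + b\<^sup>2)"
proof -
  have "\<bar>pcoef w r / 2 * (a\<^sup>2 + b\<^sup>2)\<bar> \<le> K / 2 * (a\<^sup>2 + b\<^sup>2)"
    unfolding abs_mult using assms(1) by (intro mult_mono) auto
  moreover have "\<bar>qcoef w r * (a * b)\<bar> \<le> K * ((a\<^sup>2 + b\<^sup>2) / 2)"
  proof -
    have "\<bar>a * b\<bar> \<le> (a\<^sup>2 + b\<^sup>2) / 2"
      using sum_squares_bound[of "\<bar>a\<bar>" "\<bar>b\<bar>"] by (simp add: abs_mult)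
    then show ?thesis unfolding abs_mult[of "qcoef w r"] using assms(2) by (intro mult_mono) auto
  qed
  moreover have "K * (a\<^sup>2 + b\<^sup>2) = K / 2 * (a\<^sup>2 + b\<^sup>2) + K * ((a\<^sup>2 + b\<^sup>2) / 2)" by simp
  ultimately show ?thesis unfolding mode_kernel_def by linarith
qed

text \<open>The partial derivative of the sum of the kernels of all legs in the point \<open>x i\<close>.\<close>

definition chain_grad :: "real \<Rightarrow> real \<Rightarrow> (nat \<Rightarrow> real) \<Rightarrow> nat \<Rightarrow> real" where
  "chain_grad w r x i = 2 * pcoef w r * x i + qcoef w r * (x (i - 1) + x (i + 1))"

text \<open>
  The sum of the kernels is quadratic, so the remainder of second order is its value at the
  displacement; each interior displacement enters two legs, whence the factor 2.
\<close>

lemma chain_taylor: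
  assumes K: "\<bar>pcoef w r\<bar> \<le> K" "\<bar>qcoef w r\<bar> \<le> K" and n: "0 < n"
    and ends: "x 0 = y 0" "x n = y n"
  shows "\<bar>(\<Sum>k<n. mode_kernel w r (y k) (y (Suc k))) - (\<Sum>k<n. mode_kernel w r (x k) (x (Suc k)))
      - (\<Sum>i=1..n-1. chain_grad w r x i * (y i - x i))\<bar> \<le> 2 * K * (\<Sum>i=1..n-1. (y i - x i)\<^sup>2)"
proof -
  let ?d = "\<lambda>i. y i - x i"
  let ?f = "\<lambda>i. (pcoef w r * x i + qcoef w r * x (i + 1)) * ?d i"
  let ?g = "\<lambda>i. (pcoef w r * x i + qcoef w r * x (i - 1)) * ?d i"
  have "mode_kernel w r (y k) (y (Suc k)) - mode_kernel w r (x k) (x (Suc k))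
      = mode_kernel w r (?d k) (?d (Suc k)) + ?f k + ?g (Suc k)" for k
    by (simp add: mode_kernel_def power2_eq_square field_simps)
  then have "(\<Sum>k<n. mode_kernel w r (y k) (y (Suc k))) - (\<Sum>k<n. mode_kernel w r (x k) (x (Suc k)))
      = (\<Sum>k<n. mode_kernel w r (?d k) (?d (Suc k))) + (\<Sum>k<n. ?f k) + (\<Sum>k<n. ?g (Suc k))"
    by (simp only: sum_subtractf[symmetric] sum.distrib[symmetric])
  also have "(\<Sum>k<n. ?f k) = (\<Sum>i=1..n-1. ?f i)"
    using n ends by (intro sum_interior(1)[of n ?f]) auto
  also have "(\<Sum>k<n. ?g (Suc k)) = (\<Sum>i=1..n-1. ?g i)"
    using n ends by (intro sum_interior(2)[of n ?g]) auto
  finally have "(\<Sum>k<n. mode_kernel w r (y k) (y (Suc k))) - (\<Sum>k<n. mode_kernel w r (x k) (x (Suc k)))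
      - ((\<Sum>i=1..n-1. ?f i) + (\<Sum>i=1..n-1. ?g i)) = (\<Sum>k<n. mode_kernel w r (?d k) (?d (Suc k)))"
    by linarith
  moreover have "(\<Sum>i=1..n-1. ?f i) + (\<Sum>i=1..n-1. ?g i) = (\<Sum>i=1..n-1. chain_grad w r x i * ?d i)"
    unfolding sum.distrib[symmetric] by (intro sum.cong) (auto simp: chain_grad_def algebra_simps)
  moreover have "\<bar>\<Sum>k<n. mode_kernel w r (?d k) (?d (Suc k))\<bar> \<le> 2 * K * (\<Sum>i=1..n-1. (?d i)\<^sup>2)"
  proof -
    have "\<bar>\<Sum>k<n. mode_kernel w r (?d k) (?d (Suc k))\<bar> \<le> (\<Sum>k<n. K * ((?d k)\<^sup>2 + (?d (Suc k))\<^sup>2))"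
      by (rule order_trans[OF sum_abs], rule sum_mono) (rule mode_bound[OF K])
    also have "\<dots> = K * ((\<Sum>k<n. (?d k)\<^sup>2) + (\<Sum>k<n. (?d (Suc k))\<^sup>2))"
      unfolding sum_distrib_left[symmetric] sum.distrib ..
    also have "(\<Sum>k<n. (?d k)\<^sup>2) = (\<Sum>i=1..n-1. (?d i)\<^sup>2)"
      using n ends by (intro sum_interior(1)[of n "\<lambda>i. (?d i)\<^sup>2"]) auto
    also have "(\<Sum>k<n. (?d (Suc k))\<^sup>2) = (\<Sum>i=1..n-1. (?d i)\<^sup>2)"
      using n ends by (intro sum_interior(2)[of n "\<lambda>i. (?d i)\<^sup>2"]) auto
    finally show ?thesis by simp
  qed
  ultimately show ?thesis by simp
qed

lemma chain_grad_zero_iff: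
  assumes "w \<noteq> 0" "sin (w * r) \<noteq> 0"
  shows "chain_grad w r x i = 0 \<longleftrightarrow> x (i - 1) + x (i + 1) = 2 * cos (w * r) * x i"
proof -
  have "chain_grad w r x i = qcoef w r * (x (i - 1) + x (i + 1) - 2 * cos (w * r) * x i)"
    by (simp add: chain_grad_def pcoef_cos algebra_simps)
  moreover have "qcoef w r \<noteq> 0" using assms by (simp add: qcoef_def)
  ultimately show ?thesis by simp
qed

lemma osc_path_recursion:
  assumes "w \<noteq> 0" "1 \<le> i"
  shows "osc_path w T a b (real (i - 1) * r) + osc_path w T a b (real (i + 1) * r)
    = 2 * cos (w * r) * osc_path w T a b (real i * r)"
proof -
  have arg: "real (i - 1) * r = real i * r + - r" "real (i + 1) * r = real i * r + r"
    using assms(2) by (simp_all add: of_nat_diff algebra_simps)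
  show ?thesis unfolding arg osc_path_shift[OF assms(1)] by simp
qed

context kernel_space
begin

text \<open>
  In each mode the equations for a stationary chain are a linear recursion of second order with given
  values at both ends.  The classical path over the whole horizon, sampled at the multiples of \<open>\<tau>\<close>,
  solves it, and the solution is unique because \<open>sin (\<omega> m * (n * \<tau>))\<close> does not vanish.
\<close>

lemma chain_stationary:
  assumes \<tau>: "0 < \<tau>" "\<tau> < \<mu> * sqrt 2" and n: "2 \<le> n"
    and res: "nonresonant \<tau>" and rest: "nonresonant (real n * \<tau>)"
    and \<xi>: "\<xi> \<in> X1" and \<zeta>: "\<zeta> \<in> X1"
  shows "stat (prod_X1 X1 {1..n-1}) (prod_dist1 S {1..n-1})
      (\<lambda>\<eta>. G_short X1 S \<mu> \<tau> \<xi> (\<eta> 1)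
           + (\<Sum>k=2..n-1. G_short X1 S \<mu> \<tau> (\<eta> (k-1)) (\<eta> k))
           + G_short X1 S \<mu> \<tau> (\<eta> (n-1)) \<zeta>)
    = {G_long X1 S \<phi> lam \<mu> (real n * \<tau>) \<xi> \<zeta>}"
proof -
  let ?I = "{1..n-1}" and ?Z = "prod_X1 X1 {1..n-1}" and ?d = "prod_dist1 S {1..n-1}"
  let ?F = "\<lambda>\<eta>. G_short X1 S \<mu> \<tau> \<xi> (\<eta> 1) + (\<Sum>k=2..n-1. G_short X1 S \<mu> \<tau> (\<eta> (k-1)) (\<eta> k))
           + G_short X1 S \<mu> \<tau> (\<eta> (n-1)) \<zeta>"
  let ?c = "\<lambda>m x. chain n (coord \<xi> m) (coord \<zeta> m) x"
  let ?q = "\<lambda>m x. \<Sum>k<n. mode_kernel (\<omega> m) \<tau> (?c m x k) (?c m x (Suc k))"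
  let ?U = "\<lambda>m i. osc_path (\<omega> m) (real n * \<tau>) (coord \<xi> m) (coord \<zeta> m) (real i * \<tau>)"
  have chain_coord: "coord (chain n \<xi> \<zeta> \<eta> k) m = ?c m (\<lambda>i. coord (\<eta> i) m) k" for \<eta> m k
    by (simp add: chain_def)
  have mem: "chain n \<xi> \<zeta> \<eta> k \<in> X1" if "\<eta> \<in> ?Z" "k \<le> n" for \<eta> k
    using that \<xi> \<zeta> n by (auto simp: chain_def prod_X1_def PiE_iff)
  have F_sums: "(\<lambda>m. ?q m (\<lambda>i. coord (\<eta> i) m)) sums ?F \<eta>" if \<eta>: "\<eta> \<in> ?Z" for \<eta>
  proof -
    have "?F \<eta> = (\<Sum>k<n. G_short X1 S \<mu> \<tau> (chain n \<xi> \<zeta> \<eta> k) (chain n \<xi> \<zeta> \<eta> (Suc k)))"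
      by (rule chain_sum[OF n])
    also have "\<dots> = (\<Sum>k<n. G_long X1 S \<phi> lam \<mu> \<tau> (chain n \<xi> \<zeta> \<eta> k) (chain n \<xi> \<zeta> \<eta> (Suc k)))"
      by (intro sum.cong G_short_eq_G_long \<tau> res mem \<eta>) auto
    finally show ?thesis
      unfolding chain_coord[symmetric] by (simp only:) (intro sums_sum G_long_sums res)
  qed
  obtain K where K: "K > 0" "\<And>m. \<bar>pcoef (\<omega> m) \<tau>\<bar> \<le> K" "\<And>m. \<bar>qcoef (\<omega> m) \<tau>\<bar> \<le> K"
    by (rule coef_bounds[OF res]) (rule that)
  have argstat: "argstat ?Z ?d ?F
      = {\<eta> \<in> ?Z. \<forall>m. \<forall>i\<in>?I. chain_grad (\<omega> m) \<tau> (?c m (\<lambda>i. coord (\<eta> i) m)) i = 0}"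
  proof (rule argstat_modewise[where cc = "\<lambda>\<eta> m i. coord (\<eta> i) m" and C = "2 * K" and q = ?q
        and D = "\<lambda>m x i. chain_grad (\<omega> m) \<tau> (?c m x) i"])
    show "0 \<le> ?d x y" for x y by (simp add: prod_dist1_def L2_set_nonneg)
    show "(\<lambda>m. \<Sum>i\<in>?I. (coord (y i) m - coord (z i) m)\<^sup>2) sums (?d y z)\<^sup>2"
      if "y \<in> ?Z" "z \<in> ?Z" for y z
    proof -
      have "(?d y z)\<^sup>2 = (\<Sum>i\<in>?I. (dist1 S (y i) (z i))\<^sup>2)"
        by (simp add: prod_dist1_def L2_set_def sum_nonneg)
      then show ?thesis using that
        by (simp only:) (intro sums_sum dist1_sums, auto simp: prod_X1_def PiE_iff)
    qed
    show "(\<lambda>m. ?q m (\<lambda>i. coord (y i) m)) sums ?F y" if "y \<in> ?Z" for y by (rule F_sums[OF that])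
    show "\<bar>?q m y - ?q m x - (\<Sum>i\<in>?I. chain_grad (\<omega> m) \<tau> (?c m x) i * (y i - x i))\<bar>
        \<le> 2 * K * (\<Sum>i\<in>?I. (y i - x i)\<^sup>2)" for m x y
    proof -
      have in1: "(\<Sum>i\<in>?I. chain_grad (\<omega> m) \<tau> (?c m x) i * (?c m y i - ?c m x i))
          = (\<Sum>i\<in>?I. chain_grad (\<omega> m) \<tau> (?c m x) i * (y i - x i))"
        by (rule sum.cong) (auto simp: chain_def)
      have in2: "(\<Sum>i\<in>?I. (?c m y i - ?c m x i)\<^sup>2) = (\<Sum>i\<in>?I. (y i - x i)\<^sup>2)"
        by (rule sum.cong) (auto simp: chain_def)
      have "?c m x 0 = ?c m y 0" "?c m x n = ?c m y n" by (simp_all add: chain_def)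
      moreover have "0 < n" using n by simp
      ultimately show ?thesis using chain_taylor[OF K(2)[of m] K(3)[of m], of n "?c m x" "?c m y"]
        unfolding in1 in2 by blast
    qed
    show "\<exists>y\<in>?Z. \<forall>m' i'. coord (y i') m' = coord (z i') m' + (if m' = m \<and> i' = i then e else 0)"
      if z: "z \<in> ?Z" and i: "i \<in> ?I" for z m i e
    proof -
      have zi: "z i \<in> X1" using z i by (auto simp: prod_X1_def PiE_iff)
      obtain x where x: "x \<in> X1" "\<And>k. coord x k = coord (z i) k + (if k = m then e else 0)"
        by (rule coord_bump[OF zi]) (rule that)
      have "z(i := x) \<in> ?Z" using z i x(1) by (auto simp: prod_X1_def PiE_iff extensional_def)
      then show ?thesis by (rule bexI[rotated]) (simp add: x(2))
    qed
  qed simp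
  have w_nz: "\<omega> m \<noteq> 0" for m using freq_pos[of m] by simp
  have s1: "sin (\<omega> m * \<tau>) \<noteq> 0" and sn: "sin (\<omega> m * (real n * \<tau>)) \<noteq> 0" for m
    using nonresonant_sin res rest by auto
  have U_ends: "?U m 0 = coord \<xi> m" "?U m n = coord \<zeta> m" for m
    using osc_path_endpoints[OF sn[of m], of "coord \<xi> m" "coord \<zeta> m"] by simp_all
  have "\<forall>i. \<exists>x\<in>X1. \<forall>m. coord x m = ?U m i"
  proof
    fix i
    obtain x where "x \<in> X1" "\<And>m. coord x m = ?U m i" by (rule path_point_exists[OF rest]) (rule that)
    then show "\<exists>x\<in>X1. \<forall>m. coord x m = ?U m i" by blast
  qed
  then obtain p where p: "\<And>i. p i \<in> X1" "\<And>i m. coord (p i) m = ?U m i" by metis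
  define z where "z = restrict p ?I"
  have z: "z \<in> ?Z" by (simp add: z_def prod_X1_def p(1))
  have z_chain: "?c m (\<lambda>i. coord (z i) m) i = ?U m i" if "i \<le> n" for m i
    using that U_ends by (auto simp: chain_def z_def p(2))
  have "argstat ?Z ?d ?F = {z}"
    unfolding argstat chain_grad_zero_iff[OF w_nz s1]
  proof (intro set_eqI iffI)
    fix \<eta> assume "\<eta> \<in> {z}"
    then show "\<eta> \<in> {\<eta> \<in> ?Z. \<forall>m. \<forall>i\<in>?I. ?c m (\<lambda>i. coord (\<eta> i) m) (i - 1) + ?c m (\<lambda>i. coord (\<eta> i) m) (i + 1)
        = 2 * cos (\<omega> m * \<tau>) * ?c m (\<lambda>i. coord (\<eta> i) m) i}"
      using z n osc_path_recursion[OF w_nz, where r = \<tau>] by (auto simp: z_chain)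
  next
    fix \<eta> assume "\<eta> \<in> {\<eta> \<in> ?Z. \<forall>m. \<forall>i\<in>?I. ?c m (\<lambda>i. coord (\<eta> i) m) (i - 1) + ?c m (\<lambda>i. coord (\<eta> i) m) (i + 1)
        = 2 * cos (\<omega> m * \<tau>) * ?c m (\<lambda>i. coord (\<eta> i) m) i}"
    then have \<eta>: "\<eta> \<in> ?Z" and rec: "\<And>m i. i \<in> ?I \<Longrightarrow>
        ?c m (\<lambda>i. coord (\<eta> i) m) (i - 1) + ?c m (\<lambda>i. coord (\<eta> i) m) (i + 1)
        = 2 * cos (\<omega> m * \<tau>) * ?c m (\<lambda>i. coord (\<eta> i) m) i" by auto
    have "\<eta> i = z i" if i: "i \<in> ?I" for i
    proof (rule coord_eqI)
      show "\<eta> i \<in> X1" "z i \<in> X1" using \<eta> z i by (auto simp: prod_X1_def PiE_iff)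
      fix m
      let ?e = "\<lambda>i. ?c m (\<lambda>i. coord (\<eta> i) m) i - ?U m i"
      have "?e i = 0"
      proof (rule chebyshev_recursion_zero[where n = n and \<theta> = "\<omega> m * \<tau>"])
        show "?e (j - 1) + ?e (j + 1) = 2 * cos (\<omega> m * \<tau>) * ?e j" if "1 \<le> j" "j < n" for j
        proof -
          have "j \<in> ?I" using that by simp
          from rec[OF this, of m] osc_path_recursion[OF w_nz[of m] that(1), of "real n * \<tau>" "coord \<xi> m" "coord \<zeta> m" \<tau>]
          show ?thesis unfolding right_diff_distrib by linarith
        qed
        show "?e 0 = 0" "?e n = 0" using U_ends n by (simp_all add: chain_def)
        show "sin (\<omega> m * \<tau>) \<noteq> 0" by (rule s1)
        show "sin (real n * (\<omega> m * \<tau>)) \<noteq> 0" using sn[of m] by (simp add: mult_ac)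
        show "i \<le> n" using i by auto
      qed
      then show "coord (\<eta> i) m = coord (z i) m"
        using z_chain[of i m] i by (simp add: chain_def split: if_splits)
    qed
    then have "\<eta> = z" by (rule PiE_ext[OF \<eta>[unfolded prod_X1_def] z[unfolded prod_X1_def]])
    then show "\<eta> \<in> {z}" by simp
  qed
  moreover have "?F z = G_long X1 S \<phi> lam \<mu> (real n * \<tau>) \<xi> \<zeta>"
  proof (rule sums_unique2[OF F_sums[OF z]])
    have "?q m (\<lambda>i. coord (z i) m) = mode_kernel (\<omega> m) (real n * \<tau>) (coord \<xi> m) (coord \<zeta> m)" for m
    proof -
      have "?q m (\<lambda>i. coord (z i) m) = (\<Sum>k<n. mode_kernel (\<omega> m) \<tau> (?U m k) (?U m (Suc k)))"
        by (intro sum.cong refl) (simp only: z_chain lessThan_iff less_imp_le Suc_le_eq)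
      also have "\<dots> = mode_kernel (\<omega> m) (real n * \<tau>) (coord \<xi> m) (coord \<zeta> m)"
        by (rule mode_additive_on_path[OF w_nz s1 sn refl])
      finally show ?thesis .
    qed
    then show "(\<lambda>m. ?q m (\<lambda>i. coord (z i) m)) sums G_long X1 S \<phi> lam \<mu> (real n * \<tau>) \<xi> \<zeta>"
      using G_long_sums[OF rest, of \<xi> \<zeta>] by (simp only:)
  qed
  ultimately show ?thesis by (simp add: stat_def)
qed

end

section \<open>The spectral setting\<close>

text \<open>
  With \<open>y = S f - sqrt l *\<^sub>R f\<close> one has \<open>S y = - sqrt l *\<^sub>R y\<close>, which contradicts positivity unless
  \<open>y = 0\<close>.
\<close>

lemma sqrt_op_eigenvector:
  assumes root: "is_sqrt_op E S D A" and f: "f \<in> D" "A f = l *\<^sub>R f" and "0 < l"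
  shows "f \<in> E" and "S f = sqrt l *\<^sub>R f"
proof -
  have D: "D = {x \<in> E. S x \<in> E}" and SS: "\<And>x. x \<in> D \<Longrightarrow> S (S x) = A x"
    and pos: "\<And>x. x \<in> E \<Longrightarrow> x \<noteq> 0 \<Longrightarrow> 0 < S x \<bullet> x"
    and sub: "subspace E" and add: "\<And>x y. x \<in> E \<Longrightarrow> y \<in> E \<Longrightarrow> S (x + y) = S x + S y"
    and scale: "\<And>c x. x \<in> E \<Longrightarrow> S (c *\<^sub>R x) = c *\<^sub>R S x"
    using root by (auto simp: is_sqrt_op_def self_adjoint_op_def densely_defined_op_def positive_op_def)
  show fE: "f \<in> E" using f(1) D by simp
  have SfE: "S f \<in> E" using f(1) D by simp
  define r where "r = sqrt l"
  have r: "0 < r" "l = r * r" using \<open>0 < l\<close> by (simp_all add: r_def)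
  define y where "y = S f + (- r) *\<^sub>R f"
  have y: "y \<in> E" unfolding y_def using SfE fE sub by (intro subspace_add subspace_scale)
  have "S y = S (S f) + S ((- r) *\<^sub>R f)"
    unfolding y_def by (rule add[OF SfE subspace_scale[OF sub fE]])
  also have "\<dots> = (r * r) *\<^sub>R f + (- r) *\<^sub>R S f" unfolding SS[OF f(1)] f(2) scale[OF fE] r(2) ..
  also have "\<dots> = (- r) *\<^sub>R y" unfolding y_def scaleR_right_distrib by simp
  finally have "S y \<bullet> y = - (r * (y \<bullet> y))" by simp
  also have "\<dots> \<le> 0" using r(1) by simp
  finally have "y = 0" using pos[OF y] by force
  then show "S f = sqrt l *\<^sub>R f" by (simp add: y_def r_def)
qed

lemma energy_space_of_sqrt:
  fixes \<phi> :: "nat \<Rightarrow> 'a::{real_inner,banach,second_countable_topology}"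
  assumes inv: "has_compact_inverse D A" and root: "is_sqrt_op E S D A" and onb: "orthonormal_basis \<phi>"
    and eig: "\<And>i. \<phi> i \<in> D \<and> A (\<phi> i) = lam i *\<^sub>R \<phi> i" and "0 < lam 0" "mono lam"
  shows "energy_space \<phi> E S lam"
proof
  have D: "D = {x \<in> E. S x \<in> E}" and SS: "\<And>x. x \<in> D \<Longrightarrow> S (S x) = A x"
    and pos: "\<And>x. x \<in> E \<Longrightarrow> x \<noteq> 0 \<Longrightarrow> 0 < S x \<bullet> x"
    and sym: "\<And>x y. x \<in> E \<Longrightarrow> y \<in> E \<Longrightarrow> S x \<bullet> y = x \<bullet> S y"
    and sub: "subspace E" and add: "\<And>x y. x \<in> E \<Longrightarrow> y \<in> E \<Longrightarrow> S (x + y) = S x + S y"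
    and scale: "\<And>c x. x \<in> E \<Longrightarrow> S (c *\<^sub>R x) = c *\<^sub>R S x"
    using root by (auto simp: is_sqrt_op_def self_adjoint_op_def densely_defined_op_def positive_op_def)
  show "subspace E" "\<And>x y. x \<in> E \<Longrightarrow> y \<in> E \<Longrightarrow> S (x + y) = S x + S y"
    "\<And>x c. x \<in> E \<Longrightarrow> S (c *\<^sub>R x) = c *\<^sub>R S x" by (fact sub add scale)+
  have lam: "0 < lam m" for m using \<open>0 < lam 0\<close> monoD[OF \<open>mono lam\<close>, of 0 m] by simp
  show "S x \<bullet> \<phi> m = sqrt (lam m) * (x \<bullet> \<phi> m)" if "x \<in> E" for x m
    using sqrt_op_eigenvector[OF root _ _ lam, of "\<phi> m" m] eig[of m] sym[OF that, of "\<phi> m"] by simp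
  show "bij_betw S E UNIV"
    unfolding bij_betw_def
  proof
    show "inj_on S E"
    proof (rule inj_onI)
      fix x y assume xy: "x \<in> E" "y \<in> E" "S x = S y"
      let ?d = "x + (-1) *\<^sub>R y"
      have "?d \<in> E" using xy sub by (intro subspace_add subspace_scale)
      moreover have "S ?d = 0" using xy sub add[of x "(-1) *\<^sub>R y"] scale[of y "-1"] subspace_scale by fastforce
      ultimately have "?d = 0" using pos[of ?d] by force
      then show "x = y" by simp
    qed
    have "A ` D = UNIV" using inv by (simp add: has_compact_inverse_def bij_betw_def)
    have "u \<in> S ` E" for u
    proof -
      obtain x where "x \<in> D" "A x = u" using \<open>A ` D = UNIV\<close> by (metis UNIV_I imageE)
      then have "S x \<in> E" "S (S x) = u" using D SS by auto
      then show ?thesis by blast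
    qed
    then show "S ` E = UNIV" by blast
  qed
qed (use assms in auto)

text \<open>
  Multiples of a fraction of \<open>t\<close> are nonresonant because the excluded set is closed under
  multiplication by positive rationals.
\<close>

lemma (in kernel_space) nonresonant_fraction:
  assumes lam: "filterlim lam at_top sequentially" and t: "t \<in> \<Omega> lam \<mu>" and n: "0 < n" and k: "0 < k"
  shows "nonresonant (real k * (t / real n))"
proof -
  have "t > 0" using t by (simp add: \<Omega>_def)
  have arg: "sin (c * (real k * (t / real n))) \<noteq> 0"
    if c: "0 < c" and free: "\<And>j k. 1 \<le> j \<Longrightarrow> 1 \<le> k \<Longrightarrow> t \<noteq> real j / real k * (pi / 2) * (1 / c)" for c
  proof
    assume "sin (c * (real k * (t / real n))) = 0"
    then obtain i :: int where i: "c * (real k * (t / real n)) = of_int i * pi" unfolding sin_zero_iff_int2 ..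
    have "0 < c * (real k * (t / real n))" using c n k \<open>t > 0\<close> by simp
    then have "i > 0" unfolding i by (simp add: zero_less_mult_iff)
    then obtain j where j: "0 < j" "i = int j" using zero_less_imp_eq_int by blast
    have "t = real (2 * j * n) / real k * (pi / 2) * (1 / c)"
      using i c n k by (simp add: j(2) field_simps)
    moreover have "1 \<le> 2 * j * n" using j n by simp
    ultimately show False using free[of "2 * j * n" k] k by simp
  qed
  have free: "t \<noteq> real j / real k * (pi / 2) * (1 / \<omega> m)" "t \<noteq> real j / real k * (pi / 2) * \<mu>"
    if "1 \<le> j" "1 \<le> k" for j k m
    using t that unfolding \<Omega>_def by blast+
  show ?thesis
  proof (rule nonresonantI[OF lam])
    show "sin (\<omega> m * (real k * (t / real n))) \<noteq> 0" for m
      by (rule arg[OF freq_pos free(1)])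
    have "sin (1 / \<mu> * (real k * (t / real n))) \<noteq> 0"
      by (rule arg) (use mu_pos free(2) in simp_all)
    then show "sin (real k * (t / real n) / \<mu>) \<noteq> 0" by (simp add: mult.commute)
  qed
qed

theorem theorem4p7:
  fixes X2 X1 :: "'a::{real_inner,banach,second_countable_topology} set"
    and \<Lambda> S :: "'a \<Rightarrow> 'a"
    and \<phi> :: "nat \<Rightarrow> 'a"
    and lam :: "nat \<Rightarrow> real"
    and \<mu> t \<tau> :: real
    and n :: nat
  assumes "self_adjoint_op X2 \<Lambda>" and "positive_op X2 \<Lambda>"
    and "unbounded_op X2 \<Lambda>" and "has_compact_inverse X2 \<Lambda>"
    and "is_sqrt_op X1 S X2 \<Lambda>"
    and "orthonormal_basis \<phi>"
    and "\<And>i. \<phi> i \<in> X2 \<and> \<Lambda> (\<phi> i) = lam i *\<^sub>R \<phi> i"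
    and "0 < lam 0" and "mono lam" and "filterlim lam at_top sequentially"
    and "0 < \<mu>" and "\<mu> \<le> 1"
    and "t \<in> \<Omega> lam \<mu>" and "\<mu> * sqrt 2 \<le> t"
    and "\<tau> = t / real n" and "0 < \<tau>" and "\<tau> < \<mu> * sqrt 2"
  shows "\<forall>\<xi>\<in>X1. \<forall>\<zeta>\<in>X1.
     stat (prod_X1 X1 {1..n-1}) (prod_dist1 S {1..n-1})
       (\<lambda>\<eta>. G_short X1 S \<mu> \<tau> \<xi> (\<eta> 1)
            + (\<Sum>k=2..n-1. G_short X1 S \<mu> \<tau> (\<eta> (k-1)) (\<eta> k))
            + G_short X1 S \<mu> \<tau> (\<eta> (n-1)) \<zeta>)
       = {G_long X1 S \<phi> lam \<mu> t \<xi> \<zeta>} \<and>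
     (\<forall>k\<in>{1..n-1}.
        let F = (\<lambda>\<eta>. G_long X1 S \<phi> lam \<mu> (real k * \<tau>) \<xi> \<eta>
                     + G_long X1 S \<phi> lam \<mu> (real (n-k) * \<tau>) \<eta> \<zeta>);
            M = (\<lambda>\<eta>. P_op X1 S \<phi> lam \<mu> (real k * \<tau>) \<eta>
                     + P_op X1 S \<phi> lam \<mu> (real (n-k) * \<tau>) \<eta>);
            \<eta>star = - inv_into X1 M
                       (Q_op X1 S \<phi> lam \<mu> (real k * \<tau>) \<xi> + Q_op X1 S \<phi> lam \<mu> (real (n-k) * \<tau>) \<zeta>)
        in stat X1 (dist1 S) F = {G_long X1 S \<phi> lam \<mu> t \<xi> \<zeta>} \<and>
           bij_betw M X1 X1 \<and>
           \<eta>star \<in> X1 \<and>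
           \<eta>star \<in> argstat X1 (dist1 S) F \<and>
           G_long X1 S \<phi> lam \<mu> t \<xi> \<zeta> = F \<eta>star)"
proof -
  interpret energy_space \<phi> X1 S lam
    by (rule energy_space_of_sqrt[OF assms(4-9)])
  interpret kernel_space \<phi> X1 S lam \<mu>
    by unfold_locales (rule \<open>0 < \<mu>\<close>)
  have n0: "0 < n" using \<open>\<tau> = t / real n\<close> \<open>0 < \<tau>\<close> by (cases n) auto
  have t: "t = real n * \<tau>" using \<open>\<tau> = t / real n\<close> n0 by simp
  have n2: "2 \<le> n"
  proof (rule ccontr)
    assume "\<not> 2 \<le> n"
    with n0 have "n = 1" by simp
    then show False using t \<open>\<mu> * sqrt 2 \<le> t\<close> \<open>\<tau> < \<mu> * sqrt 2\<close> by simp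
  qed
  have res: "nonresonant (real k * \<tau>)" if "0 < k" for k
    unfolding \<open>\<tau> = t / real n\<close> by (rule nonresonant_fraction[OF assms(10,13) n0 that])
  show ?thesis
  proof (intro ballI conjI)
    fix \<xi> \<zeta> assume X: "\<xi> \<in> X1" "\<zeta> \<in> X1"
    show "stat (prod_X1 X1 {1..n-1}) (prod_dist1 S {1..n-1})
       (\<lambda>\<eta>. G_short X1 S \<mu> \<tau> \<xi> (\<eta> 1)
            + (\<Sum>k=2..n-1. G_short X1 S \<mu> \<tau> (\<eta> (k-1)) (\<eta> k))
            + G_short X1 S \<mu> \<tau> (\<eta> (n-1)) \<zeta>)
       = {G_long X1 S \<phi> lam \<mu> t \<xi> \<zeta>}"
      unfolding t using res[of 1] res[OF n0]
      by (intro chain_stationary \<open>0 < \<tau>\<close> \<open>\<tau> < \<mu> * sqrt 2\<close> n2 X) simp_all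
    fix k assume k: "k \<in> {1..n-1}"
    then have legs: "nonresonant (real k * \<tau>)" "nonresonant (real (n-k) * \<tau>)" by (auto intro!: res)
    have sum: "real k * \<tau> + real (n-k) * \<tau> = t"
    proof -
      have "real (n-k) = real n - real k" using k by (intro of_nat_diff) auto
      then show ?thesis by (simp only: t left_diff_distrib)
    qed
    then have "nonresonant (real k * \<tau> + real (n-k) * \<tau>)" using res[OF n0] t by simp
    from two_leg_stationary[OF legs this X]
    show "let F = (\<lambda>\<eta>. G_long X1 S \<phi> lam \<mu> (real k * \<tau>) \<xi> \<eta>
                     + G_long X1 S \<phi> lam \<mu> (real (n-k) * \<tau>) \<eta> \<zeta>);
            M = (\<lambda>\<eta>. P_op X1 S \<phi> lam \<mu> (real k * \<tau>) \<eta>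
                     + P_op X1 S \<phi> lam \<mu> (real (n-k) * \<tau>) \<eta>);
            \<eta>star = - inv_into X1 M
                       (Q_op X1 S \<phi> lam \<mu> (real k * \<tau>) \<xi> + Q_op X1 S \<phi> lam \<mu> (real (n-k) * \<tau>) \<zeta>)
        in stat X1 (dist1 S) F = {G_long X1 S \<phi> lam \<mu> t \<xi> \<zeta>} \<and>
           bij_betw M X1 X1 \<and>
           \<eta>star \<in> X1 \<and>
           \<eta>star \<in> argstat X1 (dist1 S) F \<and>
           G_long X1 S \<phi> lam \<mu> t \<xi> \<zeta> = F \<eta>star"
      unfolding sum Let_def stat_def by simp
  qed
qed

end
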